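(* Let $\mathscr{P}(X,Y)$ be the $2$-sort species of bicolored point-determining graphs, $\mathscr{P}^s(X,Y)$ that of bicolored semi-point-determining graphs, and $\mathscr{P}^c(X,Y)$ that of bicolored connected point-determining graphs. Then $$\mathscr{P}^s(X,Y)=(1+X)(1+Y)\,\mathscr{E}\circ\mathscr{P}^c_{\ge2}(X,Y),$$ $$\mathscr{P}(X,Y)=(1+X+Y)\,\mathscr{E}\circ\mathscr{P}^c_{\ge2}(X,Y).$$
   Context: A bicolored graph is a finite simple graph whose vertices are properly colored with white and black (adjacent vertices have different colors; the coloring is part of the structure). A $2$-sort species $F(X,Y)$ assigns functorially to each pair $(U_1,U_2)$ of finite sets (and pairs of bijections) a finite set $F[U_1,U_2]$ (and bijections); equality means natural isomorphism. For $2$-sort species of bicolored graphs, structures on $(U_1,U_2)$ are bicolored graphs with set of white vertices $U_1$ (sort $X$) and set of black vertices $U_2$ (sort $Y$), with transport by relabeling. Sum is disjoint union of structures, and product is $(FG)[U_1,U_2]=\bigsqcup F[U_1',U_2']\times G[U_1'',U_2'']$ over all $U_1=U_1'\sqcup U_1''$, $U_2=U_2'\sqcup U_2''$. The species $1$, $X$, $Y$ have one structure exactly on $(\varnothing,\varnothing)$, on (singleton, $\varnothing$), and on ($\varnothing$, singleton), respectively, and no others. $\mathscr{E}$ is the species of sets; for $F[\varnothing,\varnothing]=\varnothing$, an $\mathscr{E}\circ F$-structure on $(U_1,U_2)$ is a partition of $U_1\sqcup U_2$ into nonempty blocks together with an $F$-structure on each block $B$, i.e. on $(B\cap U_1,B\cap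 U_2)$. $F_{\ge2}$ denotes the $F$-structures with at least two vertices in total; in the formulas, $\mathscr{E}\circ$ is applied to $\mathscr{P}^c_{\ge2}(X,Y)$ and the result is multiplied by the preceding factors. A bicolored graph is point-determining if in its underlying graph distinct vertices have distinct neighborhoods; it is semi-point-determining if any two distinct vertices of the same color have distinct neighborhoods. The empty graph is point-determining and semi-point-determining but not connected. *)

theory Defs
  imports Main "HOL-Library.FuncSet" "HOL-Library.Disjoint_Sets"
begin

text \<open>
  A 2-sort species is considered on the finite subsets of two arbitrary types \<open>'a\<close> (sort X) and
  \<open>'b\<close> (sort Y). \<open>structs F U1 U2\<close> is the set of structures on \<open>(U1, U2)\<close>, and
  \<open>transport F U1 U2 \<sigma> \<tau>\<close> is the map induced by a pair of bijections defined on \<open>U1\<close> and \<open>U2\<close>,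
  with values in the structures on \<open>(\<sigma> ` U1, \<tau> ` U2)\<close>. Bijections are total HOL functions of which
  only the restrictions to \<open>U1\<close> and \<open>U2\<close> matter; this is the last clause of \<open>species\<close>.
\<close>

record ('a, 'b, 's) species2 =
  structs :: "'a set \<Rightarrow> 'b set \<Rightarrow> 's set"
  transport :: "'a set \<Rightarrow> 'b set \<Rightarrow> ('a \<Rightarrow> 'a) \<Rightarrow> ('b \<Rightarrow> 'b) \<Rightarrow> 's \<Rightarrow> 's"

definition species :: "('a, 'b, 's) species2 \<Rightarrow> bool" where
  "species F \<longleftrightarrow>
     (\<forall>U1 U2. finite U1 \<longrightarrow> finite U2 \<longrightarrow> finite (structs F U1 U2)) \<and>
     (\<forall>U1 U2 V1 V2 \<sigma> \<tau>. finite U1 \<longrightarrow> finite U2 \<longrightarrow> bij_betw \<sigma> U1 V1 \<longrightarrow> bij_betw \<tau> U2 V2 \<longrightarrow>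
        bij_betw (transport F U1 U2 \<sigma> \<tau>) (structs F U1 U2) (structs F V1 V2)) \<and>
     (\<forall>U1 U2. finite U1 \<longrightarrow> finite U2 \<longrightarrow>
        (\<forall>s \<in> structs F U1 U2. transport F U1 U2 id id s = s)) \<and>
     (\<forall>U1 U2 V1 V2 W1 W2 \<sigma> \<tau> \<sigma>' \<tau>'. finite U1 \<longrightarrow> finite U2 \<longrightarrow>
        bij_betw \<sigma> U1 V1 \<longrightarrow> bij_betw \<tau> U2 V2 \<longrightarrow> bij_betw \<sigma>' V1 W1 \<longrightarrow> bij_betw \<tau>' V2 W2 \<longrightarrow>
        (\<forall>s \<in> structs F U1 U2.
           transport F U1 U2 (\<sigma>' \<circ> \<sigma>) (\<tau>' \<circ> \<tau>) s
             = transport F V1 V2 \<sigma>' \<tau>' (transport F U1 U2 \<sigma> \<tau> s))) \<and>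
     (\<forall>U1 U2 V1 V2 \<sigma> \<tau> \<sigma>' \<tau>'. finite U1 \<longrightarrow> finite U2 \<longrightarrow>
        bij_betw \<sigma> U1 V1 \<longrightarrow> bij_betw \<tau> U2 V2 \<longrightarrow>
        (\<forall>x \<in> U1. \<sigma> x = \<sigma>' x) \<longrightarrow> (\<forall>y \<in> U2. \<tau> y = \<tau>' y) \<longrightarrow>
        (\<forall>s \<in> structs F U1 U2. transport F U1 U2 \<sigma> \<tau> s = transport F U1 U2 \<sigma>' \<tau>' s))"

text \<open>Equality of species, i.e. natural isomorphism; both sides are required to be functors.\<close>

definition species_iso ::
    "('a, 'b, 's) species2 \<Rightarrow> ('a, 'b, 't) species2 \<Rightarrow> bool"  (infix "\<cong>\<^sub>s" 50) where
  "F \<cong>\<^sub>s G \<longleftrightarrow> species F \<and> species G \<and>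
     (\<exists>\<eta>. (\<forall>U1 U2. finite U1 \<longrightarrow> finite U2 \<longrightarrow>
              bij_betw (\<eta> U1 U2) (structs F U1 U2) (structs G U1 U2)) \<and>
          (\<forall>U1 U2 V1 V2 \<sigma> \<tau>. finite U1 \<longrightarrow> finite U2 \<longrightarrow>
              bij_betw \<sigma> U1 V1 \<longrightarrow> bij_betw \<tau> U2 V2 \<longrightarrow>
              (\<forall>s \<in> structs F U1 U2.
                 \<eta> V1 V2 (transport F U1 U2 \<sigma> \<tau> s) = transport G U1 U2 \<sigma> \<tau> (\<eta> U1 U2 s))))"

definition One :: "('a, 'b, unit) species2" where
  "One = \<lparr>structs = (\<lambda>U1 U2. if U1 = {} \<and> U2 = {} then {()} else {}),
          transport = (\<lambda>U1 U2 \<sigma> \<tau> s. s)\<rparr>"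

definition Sort_X :: "('a, 'b, unit) species2" where
  "Sort_X = \<lparr>structs = (\<lambda>U1 U2. if card U1 = 1 \<and> U2 = {} then {()} else {}),
             transport = (\<lambda>U1 U2 \<sigma> \<tau> s. s)\<rparr>"

definition Sort_Y :: "('a, 'b, unit) species2" where
  "Sort_Y = \<lparr>structs = (\<lambda>U1 U2. if U1 = {} \<and> card U2 = 1 then {()} else {}),
             transport = (\<lambda>U1 U2 \<sigma> \<tau> s. s)\<rparr>"

definition species_sum ::
    "('a, 'b, 's) species2 \<Rightarrow> ('a, 'b, 't) species2 \<Rightarrow> ('a, 'b, 's + 't) species2"
    (infixl "+\<^sub>s" 65) where
  "F +\<^sub>s G = \<lparr>structs = (\<lambda>U1 U2. structs F U1 U2 <+> structs G U1 U2),
            transport = (\<lambda>U1 U2 \<sigma> \<tau>. map_sum (transport F U1 U2 \<sigma> \<tau>) (transport G U1 U2 \<sigma> \<tau>))\<rparr>"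

text \<open>
  A product structure records the decompositions of \<open>U1\<close> and \<open>U2\<close> together with the structures on
  the two parts, which makes the union over all decompositions disjoint.
\<close>

definition species_prod ::
    "('a, 'b, 's) species2 \<Rightarrow> ('a, 'b, 't) species2 \<Rightarrow>
     ('a, 'b, ('a set \<times> 'b set \<times> 's) \<times> ('a set \<times> 'b set \<times> 't)) species2"
    (infixl "*\<^sub>s" 70) where
  "F *\<^sub>s G =
     \<lparr>structs = (\<lambda>U1 U2. {((A1, A2, s), (B1, B2, t)) | A1 A2 s B1 B2 t.
                   A1 \<union> B1 = U1 \<and> A1 \<inter> B1 = {} \<and> A2 \<union> B2 = U2 \<and> A2 \<inter> B2 = {} \<and>
                   s \<in> structs F A1 A2 \<and> t \<in> structs G B1 B2}),
      transport = (\<lambda>U1 U2 \<sigma> \<tau> ((A1, A2, s), (B1, B2, t)).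
                   ((\<sigma> ` A1, \<tau> ` A2, transport F A1 A2 \<sigma> \<tau> s),
                    (\<sigma> ` B1, \<tau> ` B2, transport G B1 B2 \<sigma> \<tau> t)))\<rparr>"

text \<open>
  \<open>E_comp F\<close> is the composite of the species of sets with \<open>F\<close> (meaningful when \<open>F\<close> has no structure
  on the empty pair). The disjoint union of \<open>U1\<close> and \<open>U2\<close> is \<open>U1 <+> U2\<close>; the parts of a block \<open>B\<close>
  in \<open>U1\<close> and \<open>U2\<close> are \<open>Inl -` B\<close> and \<open>Inr -` B\<close>. A structure is a pair \<open>(\<pi>, f)\<close> of a partition and a
  family of structures on its blocks, and the structure transported to a block \<open>C\<close> of the image
  partition is the one coming from the block of \<open>\<pi>\<close> mapped onto \<open>C\<close>.
\<close>

definition E_comp ::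
    "('a, 'b, 's) species2 \<Rightarrow> ('a, 'b, ('a + 'b) set set \<times> (('a + 'b) set \<Rightarrow> 's)) species2" where
  "E_comp F =
     \<lparr>structs = (\<lambda>U1 U2. SIGMA \<pi>:{\<pi>. partition_on (U1 <+> U2) \<pi>}.
                   \<Pi>\<^sub>E B\<in>\<pi>. structs F (Inl -` B) (Inr -` B)),
      transport = (\<lambda>U1 U2 \<sigma> \<tau> (\<pi>, f).
                   (image (map_sum \<sigma> \<tau>) ` \<pi>,
                    \<lambda>C \<in> image (map_sum \<sigma> \<tau>) ` \<pi>.
                      let B = inv_into \<pi> (image (map_sum \<sigma> \<tau>)) C
                      in transport F (Inl -` B) (Inr -` B) \<sigma> \<tau> (f B)))\<rparr>"

definition at_least_two :: "('a, 'b, 's) species2 \<Rightarrow> ('a, 'b, 's) species2" where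
  "at_least_two F = \<lparr>structs = (\<lambda>U1 U2. if card U1 + card U2 \<ge> 2 then structs F U1 U2 else {}),
                     transport = transport F\<rparr>"

text \<open>
  A graph is given by its vertex set and its set of edges, the edges being two-element sets of
  vertices. In a bicolored graph the vertices \<open>Inl u\<close> are the white ones and the vertices \<open>Inr u\<close>
  the black ones, so that \<open>isl\<close> is the coloring.
\<close>

definition simple_graph :: "'v set \<Rightarrow> 'v set set \<Rightarrow> bool" where
  "simple_graph V E \<longleftrightarrow> finite V \<and> (\<forall>e \<in> E. e \<subseteq> V \<and> card e = 2)"

definition bicolored_graph :: "'a set \<Rightarrow> 'b set \<Rightarrow> ('a + 'b) set set \<Rightarrow> bool" where
  "bicolored_graph U1 U2 E \<longleftrightarrow>
     simple_graph (U1 <+> U2) E \<and> (\<forall>u v. {u, v} \<in> E \<longrightarrow> isl u \<noteq> isl v)"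

definition neighborhood :: "'v set set \<Rightarrow> 'v \<Rightarrow> 'v set" where
  "neighborhood E v = {w. {v, w} \<in> E}"

definition point_determining :: "'v set \<Rightarrow> 'v set set \<Rightarrow> bool" where
  "point_determining V E \<longleftrightarrow>
     (\<forall>u \<in> V. \<forall>v \<in> V. u \<noteq> v \<longrightarrow> neighborhood E u \<noteq> neighborhood E v)"

definition semi_point_determining :: "('a + 'b) set \<Rightarrow> ('a + 'b) set set \<Rightarrow> bool" where
  "semi_point_determining V E \<longleftrightarrow>
     (\<forall>u \<in> V. \<forall>v \<in> V. u \<noteq> v \<and> isl u = isl v \<longrightarrow> neighborhood E u \<noteq> neighborhood E v)"

definition connected_graph :: "'v set \<Rightarrow> 'v set set \<Rightarrow> bool" where
  "connected_graph V E \<longleftrightarrow> V \<noteq> {} \<and> (\<forall>u \<in> V. \<forall>v \<in> V. (u, v) \<in> {(x, y). {x, y} \<in> E}\<^sup>*)"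

text \<open>The species of those bicolored graphs which satisfy \<open>Q\<close>, with transport by relabeling.\<close>

definition graph_species ::
    "(('a + 'b) set \<Rightarrow> ('a + 'b) set set \<Rightarrow> bool) \<Rightarrow> ('a, 'b, ('a + 'b) set set) species2" where
  "graph_species Q =
     \<lparr>structs = (\<lambda>U1 U2. {E. bicolored_graph U1 U2 E \<and> Q (U1 <+> U2) E}),
      transport = (\<lambda>U1 U2 \<sigma> \<tau> E. image (map_sum \<sigma> \<tau>) ` E)\<rparr>"

definition PD :: "('a, 'b, ('a + 'b) set set) species2" where
  "PD = graph_species point_determining"

definition semi_PD :: "('a, 'b, ('a + 'b) set set) species2" where
  "semi_PD = graph_species semi_point_determining"

definition connected_PD :: "('a, 'b, ('a + 'b) set set) species2" where
  "connected_PD = graph_species (\<lambda>V E. connected_graph V E \<and> point_determining V E)"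

end

theory Submission
  imports Defs
begin

text \<open>
  Two isolated vertices have the same (empty) neighborhood, whereas two vertices with a common
  nonempty neighborhood have a common neighbor; hence they lie in the same connected component,
  and in a bicolored graph they have the same color. So both conditions split into a bound on the
  isolated vertices (at most one in all for a point-determining graph, at most one of each color
  for a semi-point-determining one) and the same condition on the rest, namely that the graph
  without its isolated vertices is point-determining. The first part is the factor \<open>1 + X + Y\<close> or
  \<open>(1 + X)(1 + Y)\<close>. A graph without isolated vertices is point-determining exactly if each of its
  components is, and these components are the connected graphs with at least two vertices; this is
  the factor \<open>E_comp (at_least_two connected_PD)\<close>.

  Both steps are instances of general bijections that are visibly natural in one direction, because
  there they only form a union of edge sets. \<open>graph_species_split_isolated\<close> forgets which vertices
  were marked as isolated, and \<open>species_components\<close> forgets the partition into components. The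
  inverse maps recover these data from the edges. What the two bijections need from
  point-determining graphs is \<open>point_determining_split_isolated\<close>,
  \<open>semi_point_determining_split_isolated\<close> and \<open>point_determining_components\<close>.
\<close>

section \<open>Species and natural isomorphism\<close>

text \<open>
  Bijectivity of the transport maps is not a premise: by functoriality the transport along the
  inverse bijections is an inverse map. Writing the target sets as images leaves only injectivity
  of the relabelings to be carried along.
\<close>

lemma speciesI:
  assumes fin: "\<And>U1 U2. finite U1 \<Longrightarrow> finite U2 \<Longrightarrow> finite (structs F U1 U2)"
    and maps: "\<And>U1 U2 \<sigma> \<tau> s. \<lbrakk>finite U1; finite U2; inj_on \<sigma> U1; inj_on \<tau> U2; s \<in> structs F U1 U2\<rbrakk>
        \<Longrightarrow> transport F U1 U2 \<sigma> \<tau> s \<in> structs F (\<sigma> ` U1) (\<tau> ` U2)"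
    and ident: "\<And>U1 U2 s. \<lbrakk>finite U1; finite U2; s \<in> structs F U1 U2\<rbrakk>
        \<Longrightarrow> transport F U1 U2 id id s = s"
    and comp: "\<And>U1 U2 \<sigma> \<tau> \<sigma>' \<tau>' s. \<lbrakk>finite U1; finite U2; inj_on \<sigma> U1; inj_on \<tau> U2;
          inj_on \<sigma>' (\<sigma> ` U1); inj_on \<tau>' (\<tau> ` U2); s \<in> structs F U1 U2\<rbrakk>
        \<Longrightarrow> transport F U1 U2 (\<sigma>' \<circ> \<sigma>) (\<tau>' \<circ> \<tau>) s
              = transport F (\<sigma> ` U1) (\<tau> ` U2) \<sigma>' \<tau>' (transport F U1 U2 \<sigma> \<tau> s)"
    and cong: "\<And>U1 U2 \<sigma> \<tau> \<sigma>' \<tau>' s. \<lbrakk>finite U1; finite U2; inj_on \<sigma> U1; inj_on \<tau> U2;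
          \<And>x. x \<in> U1 \<Longrightarrow> \<sigma> x = \<sigma>' x; \<And>y. y \<in> U2 \<Longrightarrow> \<tau> y = \<tau>' y; s \<in> structs F U1 U2\<rbrakk>
        \<Longrightarrow> transport F U1 U2 \<sigma> \<tau> s = transport F U1 U2 \<sigma>' \<tau>' s"
  shows "species F"
proof -
  have inverse: "transport F (\<sigma> ` U1) (\<tau> ` U2) \<sigma>' \<tau>' (transport F U1 U2 \<sigma> \<tau> s) = s"
    if "finite U1" "finite U2" "inj_on \<sigma> U1" "inj_on \<tau> U2" "s \<in> structs F U1 U2"
      "\<And>x. x \<in> U1 \<Longrightarrow> \<sigma>' (\<sigma> x) = x" "\<And>y. y \<in> U2 \<Longrightarrow> \<tau>' (\<tau> y) = y"
    for U1 U2 \<sigma> \<tau> \<sigma>' \<tau>' s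
  proof -
    have inj: "inj_on \<sigma>' (\<sigma> ` U1)" "inj_on \<tau>' (\<tau> ` U2)"
      using that(6,7) by (auto simp: inj_on_def)
    have "transport F U1 U2 (\<sigma>' \<circ> \<sigma>) (\<tau>' \<circ> \<tau>) s = transport F U1 U2 id id s"
      using that inj by (intro cong) (auto simp: inj_on_def)
    then show ?thesis
      using comp[OF that(1-4) inj that(5)] ident[OF that(1,2,5)] by simp
  qed
  have bij: "bij_betw (transport F U1 U2 \<sigma> \<tau>) (structs F U1 U2) (structs F V1 V2)"
    if fin: "finite U1" "finite U2" and bijs: "bij_betw \<sigma> U1 V1" "bij_betw \<tau> U2 V2"
    for U1 U2 V1 V2 \<sigma> \<tau>
  proof -
    let ?\<sigma> = "inv_into U1 \<sigma>" and ?\<tau> = "inv_into U2 \<tau>"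
    have inj: "inj_on \<sigma> U1" "inj_on \<tau> U2" and V: "V1 = \<sigma> ` U1" "V2 = \<tau> ` U2"
      using bijs by (auto simp: bij_betw_def)
    have U: "?\<sigma> ` V1 = U1" "?\<tau> ` V2 = U2"
      using bijs by (auto simp: V inj inv_into_f_f intro!: rev_image_eqI)
    have inj': "inj_on ?\<sigma> V1" "inj_on ?\<tau> V2"
      unfolding V by (auto intro: inj_on_inv_into)
    have finV: "finite V1" "finite V2" using fin V by auto
    show ?thesis
    proof (rule bij_betw_byWitness[where f' = "transport F V1 V2 ?\<sigma> ?\<tau>"])
      show "\<forall>s\<in>structs F U1 U2. transport F V1 V2 ?\<sigma> ?\<tau> (transport F U1 U2 \<sigma> \<tau> s) = s"
        using fin inj by (auto simp: V intro!: inverse)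
      show "\<forall>s\<in>structs F V1 V2. transport F U1 U2 \<sigma> \<tau> (transport F V1 V2 ?\<sigma> ?\<tau> s) = s"
        using inverse[OF finV inj', of _ \<sigma> \<tau>] by (auto simp: U) (auto simp: V f_inv_into_f)
      show "transport F U1 U2 \<sigma> \<tau> ` structs F U1 U2 \<subseteq> structs F V1 V2"
        using fin inj by (auto simp: V intro!: maps)
      show "transport F V1 V2 ?\<sigma> ?\<tau> ` structs F V1 V2 \<subseteq> structs F U1 U2"
        using maps[OF finV inj'] by (auto simp: U)
    qed
  qed
  show ?thesis
    unfolding species_def
    by (intro conjI allI impI ballI fin bij ident; (assumption | (auto simp: bij_betw_def intro!: comp cong)[1])?)
qed

lemma species_finite:
  assumes "species F" "finite U1" "finite U2"
  shows "finite (structs F U1 U2)"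
  by (rule assms(1)[unfolded species_def, THEN conjunct1, rule_format, OF assms(2,3)])

lemma species_bij:
  assumes "species F" "finite U1" "finite U2" "inj_on \<sigma> U1" "inj_on \<tau> U2"
  shows "bij_betw (transport F U1 U2 \<sigma> \<tau>) (structs F U1 U2) (structs F (\<sigma> ` U1) (\<tau> ` U2))"
  by (rule assms(1)[unfolded species_def, THEN conjunct2, THEN conjunct1, rule_format,
        OF assms(2,3) inj_on_imp_bij_betw[OF assms(4)] inj_on_imp_bij_betw[OF assms(5)]])

lemma species_maps:
  "\<lbrakk>species F; finite U1; finite U2; inj_on \<sigma> U1; inj_on \<tau> U2; s \<in> structs F U1 U2\<rbrakk>
    \<Longrightarrow> transport F U1 U2 \<sigma> \<tau> s \<in> structs F (\<sigma> ` U1) (\<tau> ` U2)"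
  using species_bij by (blast dest: bij_betw_apply)

lemma species_id:
  assumes "species F" "finite U1" "finite U2" "s \<in> structs F U1 U2"
  shows "transport F U1 U2 id id s = s"
  by (rule assms(1)[unfolded species_def, THEN conjunct2, THEN conjunct2, THEN conjunct1,
        rule_format, OF assms(2-4)])

lemma species_comp:
  assumes "species F" "finite U1" "finite U2" "inj_on \<sigma> U1" "inj_on \<tau> U2"
    "inj_on \<sigma>' (\<sigma> ` U1)" "inj_on \<tau>' (\<tau> ` U2)" "s \<in> structs F U1 U2"
  shows "transport F U1 U2 (\<sigma>' \<circ> \<sigma>) (\<tau>' \<circ> \<tau>) s
           = transport F (\<sigma> ` U1) (\<tau> ` U2) \<sigma>' \<tau>' (transport F U1 U2 \<sigma> \<tau> s)"
  by (rule assms(1)[unfolded species_def, THEN conjunct2, THEN conjunct2, THEN conjunct2,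
        THEN conjunct1, rule_format, OF assms(2,3) inj_on_imp_bij_betw[OF assms(4)]
        inj_on_imp_bij_betw[OF assms(5)] inj_on_imp_bij_betw[OF assms(6)]
        inj_on_imp_bij_betw[OF assms(7)] assms(8)])

lemma species_cong:
  assumes "species F" "finite U1" "finite U2" "inj_on \<sigma> U1" "inj_on \<tau> U2"
    "\<And>x. x \<in> U1 \<Longrightarrow> \<sigma> x = \<sigma>' x" "\<And>y. y \<in> U2 \<Longrightarrow> \<tau> y = \<tau>' y" "s \<in> structs F U1 U2"
  shows "transport F U1 U2 \<sigma> \<tau> s = transport F U1 U2 \<sigma>' \<tau>' s"
  by (rule assms(1)[unfolded species_def, THEN conjunct2, THEN conjunct2, THEN conjunct2,
        THEN conjunct2, rule_format, OF assms(2,3) inj_on_imp_bij_betw[OF assms(4)]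
        inj_on_imp_bij_betw[OF assms(5)] assms(6,7,8)])

lemma species_isoI:
  assumes "species F" "species G"
    and "\<And>U1 U2. finite U1 \<Longrightarrow> finite U2 \<Longrightarrow> bij_betw (\<eta> U1 U2) (structs F U1 U2) (structs G U1 U2)"
    and "\<And>U1 U2 \<sigma> \<tau> s. \<lbrakk>finite U1; finite U2; inj_on \<sigma> U1; inj_on \<tau> U2; s \<in> structs F U1 U2\<rbrakk>
      \<Longrightarrow> \<eta> (\<sigma> ` U1) (\<tau> ` U2) (transport F U1 U2 \<sigma> \<tau> s) = transport G U1 U2 \<sigma> \<tau> (\<eta> U1 U2 s)"
  shows "F \<cong>\<^sub>s G"
proof -
  have natural: "\<eta> V1 V2 (transport F U1 U2 \<sigma> \<tau> s) = transport G U1 U2 \<sigma> \<tau> (\<eta> U1 U2 s)"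
    if "finite U1" "finite U2" "bij_betw \<sigma> U1 V1" "bij_betw \<tau> U2 V2" "s \<in> structs F U1 U2"
    for U1 U2 V1 V2 \<sigma> \<tau> s
  proof -
    have inj: "inj_on \<sigma> U1" "inj_on \<tau> U2" and V: "\<sigma> ` U1 = V1" "\<tau> ` U2 = V2"
      using that(3,4) by (simp_all add: bij_betw_def)
    show ?thesis
      using assms(4)[OF that(1,2) inj that(5)] unfolding V .
  qed
  show ?thesis
    unfolding species_iso_def
    by (intro conjI exI[of _ \<eta>] allI impI ballI assms(1-3) natural; assumption)
qed

lemma species_isoE:
  assumes "F \<cong>\<^sub>s G"
  obtains \<eta> where "species F" "species G"
    and "\<And>U1 U2. finite U1 \<Longrightarrow> finite U2 \<Longrightarrow> bij_betw (\<eta> U1 U2) (structs F U1 U2) (structs G U1 U2)"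
    and "\<And>U1 U2 \<sigma> \<tau> s. \<lbrakk>finite U1; finite U2; inj_on \<sigma> U1; inj_on \<tau> U2; s \<in> structs F U1 U2\<rbrakk>
      \<Longrightarrow> \<eta> (\<sigma> ` U1) (\<tau> ` U2) (transport F U1 U2 \<sigma> \<tau> s) = transport G U1 U2 \<sigma> \<tau> (\<eta> U1 U2 s)"
proof -
  note iso = assms[unfolded species_iso_def]
  from iso[THEN conjunct2, THEN conjunct2] obtain \<eta>
    where bij: "\<forall>U1 U2. finite U1 \<longrightarrow> finite U2 \<longrightarrow>
        bij_betw (\<eta> U1 U2) (structs F U1 U2) (structs G U1 U2)"
      and nat: "\<forall>U1 U2 V1 V2 \<sigma> \<tau>. finite U1 \<longrightarrow> finite U2 \<longrightarrow>
        bij_betw \<sigma> U1 V1 \<longrightarrow> bij_betw \<tau> U2 V2 \<longrightarrow>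
        (\<forall>s \<in> structs F U1 U2.
           \<eta> V1 V2 (transport F U1 U2 \<sigma> \<tau> s) = transport G U1 U2 \<sigma> \<tau> (\<eta> U1 U2 s))"
    by (elim exE conjE)
  show thesis
    using iso[THEN conjunct1] iso[THEN conjunct2, THEN conjunct1] bij[rule_format]
      nat[rule_format, OF _ _ inj_on_imp_bij_betw inj_on_imp_bij_betw]
    by (rule that)
qed

lemma species_iso_sym:
  fixes F :: "('a, 'b, 's) species2" and G :: "('a, 'b, 't) species2"
  assumes "F \<cong>\<^sub>s G"
  shows "G \<cong>\<^sub>s F"
proof -
  from assms obtain \<eta> where F: "species F" and G: "species G"
    and bij: "\<And>U1 U2. finite U1 \<Longrightarrow> finite U2 \<Longrightarrow>
      bij_betw (\<eta> U1 U2) (structs F U1 U2) (structs G U1 U2)"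
    and nat: "\<And>U1 U2 \<sigma> \<tau> s. \<lbrakk>finite U1; finite U2; inj_on \<sigma> U1; inj_on \<tau> U2; s \<in> structs F U1 U2\<rbrakk>
      \<Longrightarrow> \<eta> (\<sigma> ` U1) (\<tau> ` U2) (transport F U1 U2 \<sigma> \<tau> s) = transport G U1 U2 \<sigma> \<tau> (\<eta> U1 U2 s)"
    by (rule species_isoE) (rule that)
  let ?\<theta> = "\<lambda>U1 U2. inv_into (structs F U1 U2) (\<eta> U1 U2)"
  show ?thesis
  proof (rule species_isoI[where \<eta> = ?\<theta>])
    fix U1 :: "'a set" and U2 :: "'b set" and \<sigma> :: "'a \<Rightarrow> 'a" and \<tau> :: "'b \<Rightarrow> 'b" and t
    assume *: "finite U1" "finite U2" "inj_on \<sigma> U1" "inj_on \<tau> U2" and t: "t \<in> structs G U1 U2"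
    define s where "s = ?\<theta> U1 U2 t"
    have s: "s \<in> structs F U1 U2" "\<eta> U1 U2 s = t"
      using bij[OF *(1,2)] t unfolding s_def
      by (metis bij_betw_imp_surj_on inv_into_into, metis bij_betw_inv_into_right)
    have "?\<theta> (\<sigma> ` U1) (\<tau> ` U2) (transport G U1 U2 \<sigma> \<tau> t)
        = ?\<theta> (\<sigma> ` U1) (\<tau> ` U2) (\<eta> (\<sigma> ` U1) (\<tau> ` U2) (transport F U1 U2 \<sigma> \<tau> s))"
      using nat[OF * s(1)] s(2) by simp
    also have "\<dots> = transport F U1 U2 \<sigma> \<tau> s"
      using bij[of "\<sigma> ` U1" "\<tau> ` U2"] species_maps[OF F * s(1)] *
      by (intro bij_betw_inv_into_left) auto
    finally show "?\<theta> (\<sigma> ` U1) (\<tau> ` U2) (transport G U1 U2 \<sigma> \<tau> t)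
        = transport F U1 U2 \<sigma> \<tau> (?\<theta> U1 U2 t)"
      by (simp add: s_def)
  qed (rule F G bij_betw_inv_into[OF bij]; assumption)+
qed

lemma species_iso_trans:
  fixes F :: "('a, 'b, 's) species2" and G :: "('a, 'b, 't) species2"
    and H :: "('a, 'b, 'r) species2"
  assumes "F \<cong>\<^sub>s G" "G \<cong>\<^sub>s H"
  shows "F \<cong>\<^sub>s H"
proof -
  from assms(1) obtain \<eta> where F: "species F" and G: "species G"
    and bij: "\<And>U1 U2. finite U1 \<Longrightarrow> finite U2 \<Longrightarrow>
      bij_betw (\<eta> U1 U2) (structs F U1 U2) (structs G U1 U2)"
    and nat: "\<And>U1 U2 \<sigma> \<tau> s. \<lbrakk>finite U1; finite U2; inj_on \<sigma> U1; inj_on \<tau> U2; s \<in> structs F U1 U2\<rbrakk>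
      \<Longrightarrow> \<eta> (\<sigma> ` U1) (\<tau> ` U2) (transport F U1 U2 \<sigma> \<tau> s) = transport G U1 U2 \<sigma> \<tau> (\<eta> U1 U2 s)"
    by (rule species_isoE) (rule that)
  from assms(2) obtain \<theta> where G': "species G" and H: "species H"
    and bij': "\<And>U1 U2. finite U1 \<Longrightarrow> finite U2 \<Longrightarrow>
      bij_betw (\<theta> U1 U2) (structs G U1 U2) (structs H U1 U2)"
    and nat': "\<And>U1 U2 \<sigma> \<tau> s. \<lbrakk>finite U1; finite U2; inj_on \<sigma> U1; inj_on \<tau> U2; s \<in> structs G U1 U2\<rbrakk>
      \<Longrightarrow> \<theta> (\<sigma> ` U1) (\<tau> ` U2) (transport G U1 U2 \<sigma> \<tau> s) = transport H U1 U2 \<sigma> \<tau> (\<theta> U1 U2 s)"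
    by (rule species_isoE) (rule that)
  show ?thesis
  proof (rule species_isoI[where \<eta> = "\<lambda>U1 U2. \<theta> U1 U2 \<circ> \<eta> U1 U2"])
    show "\<And>U1 U2. finite U1 \<Longrightarrow> finite U2 \<Longrightarrow>
        bij_betw (\<theta> U1 U2 \<circ> \<eta> U1 U2) (structs F U1 U2) (structs H U1 U2)"
      using bij bij' by (blast intro: bij_betw_trans)
  next
    fix U1 :: "'a set" and U2 :: "'b set" and \<sigma> :: "'a \<Rightarrow> 'a" and \<tau> :: "'b \<Rightarrow> 'b" and s
    assume *: "finite U1" "finite U2" "inj_on \<sigma> U1" "inj_on \<tau> U2" "s \<in> structs F U1 U2"
    then have "\<eta> U1 U2 s \<in> structs G U1 U2"
      using bij by (blast dest: bij_betw_apply)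
    then show "(\<theta> (\<sigma> ` U1) (\<tau> ` U2) \<circ> \<eta> (\<sigma> ` U1) (\<tau> ` U2)) (transport F U1 U2 \<sigma> \<tau> s)
        = transport H U1 U2 \<sigma> \<tau> ((\<theta> U1 U2 \<circ> \<eta> U1 U2) s)"
      unfolding comp_apply nat[OF *] by (rule nat'[OF *(1-4)])
  qed (rule F H)+
qed

section \<open>Closure of species under the operations\<close>

lemma species_One: "species One"
  by (rule speciesI) (auto simp: One_def)

lemma species_Sort_X: "species Sort_X"
  by (rule speciesI) (auto simp: Sort_X_def card_image)

lemma species_Sort_Y: "species Sort_Y"
  by (rule speciesI) (auto simp: Sort_Y_def card_image)

lemma species_sum:
  assumes "species F" "species G"
  shows "species (F +\<^sub>s G)"
proof (rule speciesI)
  show "finite (structs (F +\<^sub>s G) U1 U2)" if "finite U1" "finite U2" for U1 U2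
    using that assms by (simp add: species_sum_def species_finite)
qed (use assms in \<open>auto simp: species_sum_def species_maps species_id species_comp
        intro!: species_cong[OF assms(1)] species_cong[OF assms(2)]\<close>)

lemma species_prod:
  fixes F :: "('a, 'b, 's) species2" and G :: "('a, 'b, 't) species2"
  assumes F: "species F" and G: "species G"
  shows "species (F *\<^sub>s G)"
proof (rule speciesI)
  fix U1 :: "'a set" and U2 :: "'b set"
  assume fin: "finite U1" "finite U2"
  show "finite (structs (F *\<^sub>s G) U1 U2)"
  proof (rule finite_subset)
    let ?S = "\<lambda>H. SIGMA A1:Pow U1. SIGMA A2:Pow U2. structs H A1 A2"
    show "structs (F *\<^sub>s G) U1 U2 \<subseteq> ?S F \<times> ?S G"
      by (auto simp: species_prod_def)
    show "finite (?S F \<times> ?S G)"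
      using fin F G
      by (intro finite_cartesian_product finite_SigmaI species_finite)
        (auto intro: finite_subset)
  qed
next
  fix U1 :: "'a set" and U2 :: "'b set" and \<sigma> :: "'a \<Rightarrow> 'a" and \<tau> :: "'b \<Rightarrow> 'b" and p
  assume *: "finite U1" "finite U2" "inj_on \<sigma> U1" "inj_on \<tau> U2" "p \<in> structs (F *\<^sub>s G) U1 U2"
  then obtain A1 A2 s B1 B2 t where p: "p = ((A1, A2, s), (B1, B2, t))"
    and U: "A1 \<union> B1 = U1" "A1 \<inter> B1 = {}" "A2 \<union> B2 = U2" "A2 \<inter> B2 = {}"
    and st: "s \<in> structs F A1 A2" "t \<in> structs G B1 B2"
    by (auto simp: species_prod_def)
  have sub: "A1 \<subseteq> U1" "A2 \<subseteq> U2" "B1 \<subseteq> U1" "B2 \<subseteq> U2" using U by auto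
  have fin: "finite A1" "finite A2" "finite B1" "finite B2"
    using sub * by (auto intro: finite_subset)
  have inj: "inj_on \<sigma> A1" "inj_on \<tau> A2" "inj_on \<sigma> B1" "inj_on \<tau> B2"
    using sub * by (auto intro: inj_on_subset)
  have disj: "\<sigma> ` A1 \<inter> \<sigma> ` B1 = {}" "\<tau> ` A2 \<inter> \<tau> ` B2 = {}"
    using U * sub by (metis image_empty inj_on_image_Int)+
  show "transport (F *\<^sub>s G) U1 U2 \<sigma> \<tau> p \<in> structs (F *\<^sub>s G) (\<sigma> ` U1) (\<tau> ` U2)"
    using U disj species_maps[OF F fin(1,2) inj(1,2) st(1)] species_maps[OF G fin(3,4) inj(3,4) st(2)]
    by (auto simp: species_prod_def p)
  show "transport (F *\<^sub>s G) U1 U2 (\<sigma>' \<circ> \<sigma>) (\<tau>' \<circ> \<tau>) p =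
      transport (F *\<^sub>s G) (\<sigma> ` U1) (\<tau> ` U2) \<sigma>' \<tau>' (transport (F *\<^sub>s G) U1 U2 \<sigma> \<tau> p)"
    if "inj_on \<sigma>' (\<sigma> ` U1)" "inj_on \<tau>' (\<tau> ` U2)" for \<sigma>' \<tau>'
  proof -
    have inj': "inj_on \<sigma>' (\<sigma> ` A1)" "inj_on \<tau>' (\<tau> ` A2)" "inj_on \<sigma>' (\<sigma> ` B1)" "inj_on \<tau>' (\<tau> ` B2)"
      using sub that by (blast intro: inj_on_subset)+
    show ?thesis
      using species_comp[OF F fin(1,2) inj(1,2) inj'(1,2) st(1)]
        species_comp[OF G fin(3,4) inj(3,4) inj'(3,4) st(2)]
      by (simp add: species_prod_def p image_comp)
  qed
  show "transport (F *\<^sub>s G) U1 U2 \<sigma> \<tau> p = transport (F *\<^sub>s G) U1 U2 \<sigma>' \<tau>' p"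
    if eq: "\<And>x. x \<in> U1 \<Longrightarrow> \<sigma> x = \<sigma>' x" "\<And>y. y \<in> U2 \<Longrightarrow> \<tau> y = \<tau>' y" for \<sigma>' \<tau>'
  proof -
    have "transport F A1 A2 \<sigma> \<tau> s = transport F A1 A2 \<sigma>' \<tau>' s"
      "transport G B1 B2 \<sigma> \<tau> t = transport G B1 B2 \<sigma>' \<tau>' t"
      using sub eq by (auto intro!: species_cong[OF F fin(1,2) inj(1,2) _ _ st(1)]
          species_cong[OF G fin(3,4) inj(3,4) _ _ st(2)])
    moreover have "\<sigma> ` A1 = \<sigma>' ` A1" "\<tau> ` A2 = \<tau>' ` A2" "\<sigma> ` B1 = \<sigma>' ` B1" "\<tau> ` B2 = \<tau>' ` B2"
      using sub eq by (auto intro!: image_cong)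
    ultimately show ?thesis by (simp add: species_prod_def p)
  qed
next
  fix U1 :: "'a set" and U2 :: "'b set" and p
  assume "finite U1" "finite U2" "p \<in> structs (F *\<^sub>s G) U1 U2"
  then show "transport (F *\<^sub>s G) U1 U2 id id p = p"
    by (auto simp: species_prod_def species_id F G)
qed

lemma species_prod_cong_right:
  fixes F :: "('a, 'b, 's) species2" and G :: "('a, 'b, 't) species2"
    and H :: "('a, 'b, 'r) species2"
  assumes F: "species F" and "G \<cong>\<^sub>s H"
  shows "F *\<^sub>s G \<cong>\<^sub>s F *\<^sub>s H"
proof -
  from assms(2) obtain \<eta> where G: "species G" and H: "species H"
    and bij: "\<And>U1 U2. finite U1 \<Longrightarrow> finite U2 \<Longrightarrow>
      bij_betw (\<eta> U1 U2) (structs G U1 U2) (structs H U1 U2)"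
    and nat: "\<And>U1 U2 \<sigma> \<tau> s. \<lbrakk>finite U1; finite U2; inj_on \<sigma> U1; inj_on \<tau> U2; s \<in> structs G U1 U2\<rbrakk>
      \<Longrightarrow> \<eta> (\<sigma> ` U1) (\<tau> ` U2) (transport G U1 U2 \<sigma> \<tau> s) = transport H U1 U2 \<sigma> \<tau> (\<eta> U1 U2 s)"
    by (rule species_isoE) (rule that)
  let ?\<theta> = "\<lambda>U1 U2 (a, (B1, B2, t)). (a, (B1, B2, \<eta> B1 B2 t))"
  let ?\<theta>' = "\<lambda>U1 U2 (a, (B1, B2, t)). (a, (B1, B2, inv_into (structs G B1 B2) (\<eta> B1 B2) t))"
  show ?thesis
  proof (rule species_isoI[where \<eta> = ?\<theta>])
    fix U1 :: "'a set" and U2 :: "'b set"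
    assume fin: "finite U1" "finite U2"
    have bijB: "bij_betw (\<eta> B1 B2) (structs G B1 B2) (structs H B1 B2)"
      if "A1 \<union> B1 = U1" "A2 \<union> B2 = U2" for A1 A2 B1 B2
      using that fin by (intro bij) (auto intro: finite_subset)
    show "bij_betw (?\<theta> U1 U2) (structs (F *\<^sub>s G) U1 U2) (structs (F *\<^sub>s H) U1 U2)"
      by (rule bij_betw_byWitness[where f' = "?\<theta>' U1 U2"])
        (auto simp: species_prod_def bij_betw_inv_into_left[OF bijB]
          bij_betw_inv_into_right[OF bijB] bij_betw_apply[OF bijB]
          bij_betw_apply[OF bij_betw_inv_into[OF bijB]])
  next
    fix U1 :: "'a set" and U2 :: "'b set" and \<sigma> :: "'a \<Rightarrow> 'a" and \<tau> :: "'b \<Rightarrow> 'b" and s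
    assume "finite U1" "finite U2" "inj_on \<sigma> U1" "inj_on \<tau> U2" "s \<in> structs (F *\<^sub>s G) U1 U2"
    then show "?\<theta> (\<sigma> ` U1) (\<tau> ` U2) (transport (F *\<^sub>s G) U1 U2 \<sigma> \<tau> s)
        = transport (F *\<^sub>s H) U1 U2 \<sigma> \<tau> (?\<theta> U1 U2 s)"
      by (auto simp: species_prod_def inj_on_Un intro!: nat)
  qed (intro species_prod F G H)+
qed

section \<open>Relabeling of blocks and the composite with sets\<close>

lemma map_sum_image_Plus: "map_sum \<sigma> \<tau> ` (A <+> B) = \<sigma> ` A <+> \<tau> ` B"
  by (simp add: Plus_def image_Un image_image)

lemma vimage_Inl_map_sum: "Inl -` (map_sum \<sigma> \<tau> ` B) = \<sigma> ` (Inl -` B)"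
proof (rule set_eqI)
  have "Inl x = map_sum \<sigma> \<tau> z \<longleftrightarrow> (\<exists>y. z = Inl y \<and> x = \<sigma> y)" for x z
    by (cases z) auto
  then show "x \<in> Inl -` (map_sum \<sigma> \<tau> ` B) \<longleftrightarrow> x \<in> \<sigma> ` (Inl -` B)" for x
    by (auto simp: image_iff)
qed

lemma vimage_Inr_map_sum: "Inr -` (map_sum \<sigma> \<tau> ` B) = \<tau> ` (Inr -` B)"
proof (rule set_eqI)
  have "Inr x = map_sum \<sigma> \<tau> z \<longleftrightarrow> (\<exists>y. z = Inr y \<and> x = \<tau> y)" for x z
    by (cases z) auto
  then show "x \<in> Inr -` (map_sum \<sigma> \<tau> ` B) \<longleftrightarrow> x \<in> \<tau> ` (Inr -` B)" for x
    by (auto simp: image_iff)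
qed

lemma Plus_vimage [simp]: "(Inl -` B) <+> (Inr -` B) = B"
proof (rule set_eqI)
  show "x \<in> (Inl -` B) <+> (Inr -` B) \<longleftrightarrow> x \<in> B" for x by (cases x) auto
qed

lemma inj_on_map_sum_Plus:
  "\<lbrakk>inj_on \<sigma> A; inj_on \<tau> B\<rbrakk> \<Longrightarrow> inj_on (map_sum \<sigma> \<tau>) (A <+> B)"
  by (rule inj_onI) (auto dest: inj_onD)

lemma isl_map_sum [simp]: "isl (map_sum \<sigma> \<tau> u) = isl u"
  by (cases u) auto

lemma E_comp_block:
  assumes "(\<pi>, f) \<in> structs (E_comp F) U1 U2" "B \<in> \<pi>"
  shows "B \<subseteq> U1 <+> U2" "Inl -` B \<subseteq> U1" "Inr -` B \<subseteq> U2"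
    "f B \<in> structs F (Inl -` B) (Inr -` B)"
proof -
  show "B \<subseteq> U1 <+> U2"
    using assms by (auto simp: E_comp_def partition_on_def)
  then show "Inl -` B \<subseteq> U1" "Inr -` B \<subseteq> U2" by auto
  show "f B \<in> structs F (Inl -` B) (Inr -` B)"
    using assms by (auto simp: E_comp_def PiE_iff)
qed

lemma E_comp_inj_on_blocks:
  assumes "(\<pi>, f) \<in> structs (E_comp F) U1 U2" "inj_on \<sigma> U1" "inj_on \<tau> U2"
  shows "inj_on (image (map_sum \<sigma> \<tau>)) \<pi>"
proof (rule inj_on_subset)
  show "inj_on (image (map_sum \<sigma> \<tau>)) (Pow (U1 <+> U2))"
    by (intro inj_on_image_Pow inj_on_map_sum_Plus assms(2,3))
  show "\<pi> \<subseteq> Pow (U1 <+> U2)"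
    using E_comp_block(1)[OF assms(1)] by blast
qed

text \<open>
  A relabeling is injective on blocks, so the inverse image chosen in \<open>E_comp\<close> is forced and the
  transported family is determined by its values on the images of the original blocks.
\<close>

lemma E_comp_transport_eqI:
  assumes p: "(\<pi>, f) \<in> structs (E_comp F) U1 U2" and inj: "inj_on \<sigma> U1" "inj_on \<tau> U2"
    and \<pi>': "\<pi>' = image (map_sum \<sigma> \<tau>) ` \<pi>" and ext: "f' \<in> extensional \<pi>'"
    and f': "\<And>B. B \<in> \<pi> \<Longrightarrow>
      f' (map_sum \<sigma> \<tau> ` B) = transport F (Inl -` B) (Inr -` B) \<sigma> \<tau> (f B)"
  shows "transport (E_comp F) U1 U2 \<sigma> \<tau> (\<pi>, f) = (\<pi>', f')"
proof -
  let ?m = "map_sum \<sigma> \<tau>"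
  have "inj_on (image ?m) \<pi>"
    by (rule E_comp_inj_on_blocks[OF p inj])
  then have "(\<lambda>C \<in> image ?m ` \<pi>. let B = inv_into \<pi> (image ?m) C
      in transport F (Inl -` B) (Inr -` B) \<sigma> \<tau> (f B)) = f'"
    using ext unfolding \<pi>' by (intro extensionalityI) (auto simp: f')
  then show ?thesis by (simp add: E_comp_def \<pi>')
qed

lemma E_comp_transport_block:
  assumes "(\<pi>, f) \<in> structs (E_comp F) U1 U2" "inj_on \<sigma> U1" "inj_on \<tau> U2" "B \<in> \<pi>"
  shows "snd (transport (E_comp F) U1 U2 \<sigma> \<tau> (\<pi>, f)) (map_sum \<sigma> \<tau> ` B)
      = transport F (Inl -` B) (Inr -` B) \<sigma> \<tau> (f B)"
proof -
  have "inj_on (image (map_sum \<sigma> \<tau>)) \<pi>"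
    by (rule E_comp_inj_on_blocks[OF assms(1-3)])
  then show ?thesis using assms(4) by (simp add: E_comp_def)
qed

lemma species_E_comp:
  fixes F :: "('a, 'b, 's) species2"
  assumes F: "species F"
  shows "species (E_comp F)"
proof (rule speciesI)
  fix U1 :: "'a set" and U2 :: "'b set"
  assume fin: "finite U1" "finite U2"
  show "finite (structs (E_comp F) U1 U2)"
    unfolding E_comp_def species2.simps
  proof (intro finite_SigmaI finite_PiE)
    show "finite {\<pi>. partition_on (U1 <+> U2) \<pi>}"
      using fin by (intro finitely_many_partition_on) simp
    fix \<pi> assume "\<pi> \<in> {\<pi>. partition_on (U1 <+> U2) \<pi>}"
    then have \<pi>: "partition_on (U1 <+> U2) \<pi>" by simp
    show "finite \<pi>"
      using finite_elements[OF _ \<pi>] fin by simp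
    fix B assume "B \<in> \<pi>"
    then have "B \<subseteq> U1 <+> U2" using \<pi> by (auto simp: partition_on_def)
    then have "Inl -` B \<subseteq> U1" "Inr -` B \<subseteq> U2" by auto
    then show "finite (structs F (Inl -` B) (Inr -` B))"
      using fin by (intro species_finite[OF F]) (auto intro: finite_subset)
  qed
next
  fix U1 :: "'a set" and U2 :: "'b set" and \<sigma> :: "'a \<Rightarrow> 'a" and \<tau> :: "'b \<Rightarrow> 'b" and p
  assume *: "finite U1" "finite U2" "inj_on \<sigma> U1" "inj_on \<tau> U2" "p \<in> structs (E_comp F) U1 U2"
  obtain \<pi> f where p: "p = (\<pi>, f)" by (cases p)
  note st = *(5)[unfolded p]
  let ?m = "map_sum \<sigma> \<tau>"
  obtain f1 where tr: "transport (E_comp F) U1 U2 \<sigma> \<tau> (\<pi>, f) = (image ?m ` \<pi>, f1)"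
    and ext1: "f1 \<in> extensional (image ?m ` \<pi>)"
    by (auto simp: E_comp_def)
  have f1: "f1 (?m ` B) = transport F (Inl -` B) (Inr -` B) \<sigma> \<tau> (f B)" if "B \<in> \<pi>" for B
    using E_comp_transport_block[OF st *(3,4) that] tr by simp
  have block: "finite (Inl -` B)" "finite (Inr -` B)" "inj_on \<sigma> (Inl -` B)" "inj_on \<tau> (Inr -` B)"
    if "B \<in> \<pi>" for B
    using E_comp_block(2,3)[OF st that] *(1-4) by (auto intro: finite_subset inj_on_subset)
  show maps: "transport (E_comp F) U1 U2 \<sigma> \<tau> p \<in> structs (E_comp F) (\<sigma> ` U1) (\<tau> ` U2)"
  proof -
    have part: "partition_on (U1 <+> U2) \<pi>" using st by (simp add: E_comp_def)
    have "partition_on (?m ` (U1 <+> U2)) (image ?m ` \<pi> - {{}})"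
      by (rule partition_on_inj_image[OF part inj_on_map_sum_Plus[OF *(3,4)]])
    moreover have "image ?m ` \<pi> - {{}} = image ?m ` \<pi>"
      using partition_onD3[OF part] by auto
    ultimately have "partition_on (\<sigma> ` U1 <+> \<tau> ` U2) (image ?m ` \<pi>)"
      by (simp add: map_sum_image_Plus)
    moreover have "f1 (?m ` B) \<in> structs F (Inl -` (?m ` B)) (Inr -` (?m ` B))" if "B \<in> \<pi>" for B
      using species_maps[OF F block[OF that] E_comp_block(4)[OF st that]]
      by (simp add: f1[OF that] vimage_Inl_map_sum vimage_Inr_map_sum)
    ultimately show ?thesis
      using ext1 by (auto simp: p tr) (auto simp: E_comp_def PiE_def)
  qed
  show "transport (E_comp F) U1 U2 (\<sigma>' \<circ> \<sigma>) (\<tau>' \<circ> \<tau>) p =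
      transport (E_comp F) (\<sigma> ` U1) (\<tau> ` U2) \<sigma>' \<tau>' (transport (E_comp F) U1 U2 \<sigma> \<tau> p)"
    if inj': "inj_on \<sigma>' (\<sigma> ` U1)" "inj_on \<tau>' (\<tau> ` U2)" for \<sigma>' \<tau>'
  proof -
    let ?m' = "map_sum \<sigma>' \<tau>'"
    have st1: "(image ?m ` \<pi>, f1) \<in> structs (E_comp F) (\<sigma> ` U1) (\<tau> ` U2)"
      using maps by (simp add: p tr)
    obtain f2 where tr2: "transport (E_comp F) (\<sigma> ` U1) (\<tau> ` U2) \<sigma>' \<tau>' (image ?m ` \<pi>, f1)
        = (image ?m' ` image ?m ` \<pi>, f2)" and ext2: "f2 \<in> extensional (image ?m' ` image ?m ` \<pi>)"
      by (auto simp: E_comp_def)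
    have m: "map_sum (\<sigma>' \<circ> \<sigma>) (\<tau>' \<circ> \<tau>) = ?m' \<circ> ?m" by (simp add: map_sum.comp)
    have "transport (E_comp F) U1 U2 (\<sigma>' \<circ> \<sigma>) (\<tau>' \<circ> \<tau>) (\<pi>, f) = (image ?m' ` image ?m ` \<pi>, f2)"
    proof (rule E_comp_transport_eqI[OF st])
      show "inj_on (\<sigma>' \<circ> \<sigma>) U1" "inj_on (\<tau>' \<circ> \<tau>) U2"
        using * inj' by (auto intro: comp_inj_on)
      show "image ?m' ` image ?m ` \<pi> = image (map_sum (\<sigma>' \<circ> \<sigma>) (\<tau>' \<circ> \<tau>)) ` \<pi>"
        by (simp add: m image_image)
      fix B assume B: "B \<in> \<pi>"
      have "f2 (?m' ` ?m ` B) = transport F (\<sigma> ` (Inl -` B)) (\<tau> ` (Inr -` B)) \<sigma>' \<tau>' (f1 (?m ` B))"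
        using E_comp_transport_block[OF st1 inj', of "?m ` B"] B
        by (simp add: tr2 vimage_Inl_map_sum vimage_Inr_map_sum)
      also have "\<dots> = transport F (Inl -` B) (Inr -` B) (\<sigma>' \<circ> \<sigma>) (\<tau>' \<circ> \<tau>) (f B)"
        unfolding f1[OF B]
      proof (rule species_comp[OF F block[OF B] _ _ E_comp_block(4)[OF st B], symmetric])
        show "inj_on \<sigma>' (\<sigma> ` (Inl -` B))" "inj_on \<tau>' (\<tau> ` (Inr -` B))"
          using E_comp_block(2,3)[OF st B] inj' by (blast intro: inj_on_subset)+
      qed
      finally show "f2 (map_sum (\<sigma>' \<circ> \<sigma>) (\<tau>' \<circ> \<tau>) ` B)
          = transport F (Inl -` B) (Inr -` B) (\<sigma>' \<circ> \<sigma>) (\<tau>' \<circ> \<tau>) (f B)"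
        by (simp add: m image_comp)
    qed (rule ext2)
    then show ?thesis by (simp add: p tr tr2)
  qed
  show "transport (E_comp F) U1 U2 \<sigma> \<tau> p = transport (E_comp F) U1 U2 \<sigma>' \<tau>' p"
    if eq: "\<And>x. x \<in> U1 \<Longrightarrow> \<sigma> x = \<sigma>' x" "\<And>y. y \<in> U2 \<Longrightarrow> \<tau> y = \<tau>' y" for \<sigma>' \<tau>'
  proof -
    have m: "map_sum \<sigma>' \<tau>' ` B = ?m ` B" if "B \<in> \<pi>" for B
      using E_comp_block(1)[OF st that] eq by (intro image_cong) (auto simp: Plus_def)
    have "transport (E_comp F) U1 U2 \<sigma>' \<tau>' (\<pi>, f) = (image ?m ` \<pi>, f1)"
    proof (rule E_comp_transport_eqI[OF st])
      show "inj_on \<sigma>' U1" "inj_on \<tau>' U2"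
        using *(3,4) eq by (simp_all cong: inj_on_cong)
      show "image ?m ` \<pi> = image (map_sum \<sigma>' \<tau>') ` \<pi>"
        by (simp add: m)
      fix B assume B: "B \<in> \<pi>"
      show "f1 (map_sum \<sigma>' \<tau>' ` B) = transport F (Inl -` B) (Inr -` B) \<sigma>' \<tau>' (f B)"
        unfolding m[OF B] f1[OF B] using E_comp_block(2,3)[OF st B]
        by (intro species_cong[OF F block[OF B] _ _ E_comp_block(4)[OF st B]] eq; blast)
    qed (rule ext1)
    then show ?thesis by (simp add: p tr)
  qed
next
  fix U1 :: "'a set" and U2 :: "'b set" and p
  assume *: "finite U1" "finite U2" "p \<in> structs (E_comp F) U1 U2"
  obtain \<pi> f where p: "p = (\<pi>, f)" by (cases p)
  note st = *(3)[unfolded p]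
  have "transport (E_comp F) U1 U2 id id (\<pi>, f) = (\<pi>, f)"
  proof (rule E_comp_transport_eqI[OF st])
    show "f \<in> extensional \<pi>" using st by (auto simp: E_comp_def PiE_def)
    fix B assume B: "B \<in> \<pi>"
    show "f (map_sum id id ` B) = transport F (Inl -` B) (Inr -` B) id id (f B)"
      using species_id[OF F _ _ E_comp_block(4)[OF st B]]
        finite_subset[OF E_comp_block(2)[OF st B] *(1)] finite_subset[OF E_comp_block(3)[OF st B] *(2)]
      by (simp add: map_sum.id)
  qed (auto simp: map_sum.id)
  then show "transport (E_comp F) U1 U2 id id p = p" by (simp add: p)
qed


section \<open>Relabeling graphs\<close>

lemma bicolored_graphD:
  assumes "bicolored_graph U1 U2 E"
  shows "finite U1" "finite U2" "\<And>e. e \<in> E \<Longrightarrow> e \<subseteq> U1 <+> U2" "\<And>e. e \<in> E \<Longrightarrow> card e = 2"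
    "\<And>u v. {u, v} \<in> E \<Longrightarrow> isl u \<noteq> isl v" "\<And>u v. {u, v} \<in> E \<Longrightarrow> u \<in> U1 <+> U2"
    "\<And>u v. {u, v} \<in> E \<Longrightarrow> v \<in> U1 <+> U2"
proof -
  show "finite U1" "finite U2" "\<And>e. e \<in> E \<Longrightarrow> e \<subseteq> U1 <+> U2" "\<And>e. e \<in> E \<Longrightarrow> card e = 2"
    "\<And>u v. {u, v} \<in> E \<Longrightarrow> isl u \<noteq> isl v"
    using assms by (auto simp: bicolored_graph_def simple_graph_def)
  then show "\<And>u v. {u, v} \<in> E \<Longrightarrow> u \<in> U1 <+> U2" "\<And>u v. {u, v} \<in> E \<Longrightarrow> v \<in> U1 <+> U2"
    by blast+
qed

lemma bicolored_graph_edgeE: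
  assumes "bicolored_graph U1 U2 E" "e \<in> E"
  obtains u v where "e = {u, v}" "isl u \<noteq> isl v"
  using bicolored_graphD(4,5)[OF assms(1)] assms(2) by (metis card_2_iff)

lemma bicolored_graph_relabel:
  assumes E: "bicolored_graph U1 U2 E" and inj: "inj_on \<sigma> U1" "inj_on \<tau> U2"
  shows "bicolored_graph (\<sigma> ` U1) (\<tau> ` U2) (image (map_sum \<sigma> \<tau>) ` E)"
proof -
  let ?m = "map_sum \<sigma> \<tau>"
  have "?m ` e \<subseteq> \<sigma> ` U1 <+> \<tau> ` U2" "card (?m ` e) = 2" if "e \<in> E" for e
  proof -
    have e: "e \<subseteq> U1 <+> U2" "card e = 2" using bicolored_graphD(3,4)[OF E that] .
    then show "?m ` e \<subseteq> \<sigma> ` U1 <+> \<tau> ` U2"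
      unfolding map_sum_image_Plus[symmetric] by blast
    show "card (?m ` e) = 2"
      using card_image[OF inj_on_subset[OF inj_on_map_sum_Plus[OF inj] e(1)]] e(2) by simp
  qed
  moreover have "isl u \<noteq> isl v" if uv: "{u, v} \<in> image ?m ` E" for u v
  proof -
    from uv obtain e where e: "e \<in> E" "{u, v} = ?m ` e" by blast
    from E e(1) obtain a b where ab: "e = {a, b}" "isl a \<noteq> isl b" by (rule bicolored_graph_edgeE)
    have "(u = ?m a \<and> v = ?m b) \<or> (u = ?m b \<and> v = ?m a)"
      using e(2) by (simp add: ab(1) doubleton_eq_iff)
    then show ?thesis using ab(2) by auto
  qed
  ultimately show ?thesis
    using bicolored_graphD(1,2)[OF E] unfolding bicolored_graph_def simple_graph_def by auto
qed

text \<open>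
  Injectivity on all of \<open>V\<close> matters here: otherwise an edge at another vertex identified with \<open>v\<close>
  would contribute new neighbors.
\<close>

lemma neighborhood_image:
  assumes inj: "inj_on m V" and E: "E \<subseteq> Pow V" and v: "v \<in> V"
  shows "neighborhood (image m ` E) (m v) = m ` neighborhood E v"
proof (intro equalityI subsetI)
  fix w assume "w \<in> neighborhood (image m ` E) (m v)"
  then obtain e where e: "e \<in> E" "{m v, w} = m ` e"
    by (auto simp: neighborhood_def)
  then obtain x where x: "x \<in> e" "w = m x" by blast
  have "m ` {v, x} = m ` e" using e(2) x(2) by simp
  then have "{v, x} = e"
    using inj_on_image_eq_iff[OF inj, of "{v, x}" e] v E e(1) x(1) by blast
  then show "w \<in> m ` neighborhood E v"
    using e(1) x(2) by (auto simp: neighborhood_def)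
next
  fix w assume "w \<in> m ` neighborhood E v"
  then obtain x where "{v, x} \<in> E" "w = m x" by (auto simp: neighborhood_def)
  then show "w \<in> neighborhood (image m ` E) (m v)"
    using imageI[of "{v, x}" E "image m"] by (simp add: neighborhood_def)
qed

lemma neighborhood_image_eq_iff:
  assumes m: "inj_on m V" and E: "E \<subseteq> Pow V" and "u \<in> V" "v \<in> V"
  shows "neighborhood (image m ` E) (m u) = neighborhood (image m ` E) (m v)
    \<longleftrightarrow> neighborhood E u = neighborhood E v"
proof -
  have "neighborhood E w \<subseteq> V" for w using E by (fastforce simp: neighborhood_def)
  then show ?thesis
    by (simp add: neighborhood_image[OF m E] assms(3,4) inj_on_image_eq_iff[OF m])
qed

text \<open>
  Only relabelings that preserve the colors are considered, since semi-point-determination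
  depends on them.
\<close>

definition relabel_invariant :: "(('a + 'b) set \<Rightarrow> ('a + 'b) set set \<Rightarrow> bool) \<Rightarrow> bool" where
  "relabel_invariant Q \<longleftrightarrow> (\<forall>U1 U2 E (\<sigma> :: 'a \<Rightarrow> 'a) (\<tau> :: 'b \<Rightarrow> 'b). bicolored_graph U1 U2 E \<longrightarrow> inj_on \<sigma> U1 \<longrightarrow>
     inj_on \<tau> U2 \<longrightarrow> Q (U1 <+> U2) E \<longrightarrow>
     Q (map_sum \<sigma> \<tau> ` (U1 <+> U2)) (image (map_sum \<sigma> \<tau>) ` E))"

lemma relabel_invariantI:
  fixes Q :: "('a + 'b) set \<Rightarrow> ('a + 'b) set set \<Rightarrow> bool"
  assumes "\<And>V E m. \<lbrakk>E \<subseteq> Pow V; inj_on m V; \<And>v. isl (m v) = isl v; Q V E\<rbrakk>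
    \<Longrightarrow> Q (m ` V) (image m ` E)"
  shows "relabel_invariant Q"
  unfolding relabel_invariant_def
proof (intro allI impI)
  fix U1 U2 E and \<sigma> :: "'a \<Rightarrow> 'a" and \<tau> :: "'b \<Rightarrow> 'b"
  assume *: "bicolored_graph U1 U2 E" "inj_on \<sigma> U1" "inj_on \<tau> U2" "Q (U1 <+> U2) E"
  show "Q (map_sum \<sigma> \<tau> ` (U1 <+> U2)) (image (map_sum \<sigma> \<tau>) ` E)"
    using bicolored_graphD(3)[OF *(1)]
    by (intro assms inj_on_map_sum_Plus isl_map_sum *) blast
qed

lemma relabel_invariant_conj:
  "\<lbrakk>relabel_invariant P; relabel_invariant Q\<rbrakk> \<Longrightarrow> relabel_invariant (\<lambda>V E. P V E \<and> Q V E)"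
  unfolding relabel_invariant_def by blast

lemma relabel_invariant_point_determining: "relabel_invariant point_determining"
proof (rule relabel_invariantI)
  fix V and E :: "('a + 'b) set set" and m :: "'a + 'b \<Rightarrow> 'a + 'b"
  assume E: "E \<subseteq> Pow V" and m: "inj_on m V" and pd: "point_determining V E"
  show "point_determining (m ` V) (image m ` E)"
    unfolding point_determining_def
  proof (intro ballI impI; elim imageE)
    fix u' v' u v assume "u' \<noteq> v'" and uv: "u' = m u" "u \<in> V" "v' = m v" "v \<in> V"
    then have "u \<noteq> v" by auto
    then have "neighborhood E u \<noteq> neighborhood E v"
      using pd uv(2,4) by (simp add: point_determining_def)
    then show "neighborhood (image m ` E) u' \<noteq> neighborhood (image m ` E) v'"
      unfolding uv(1,3) neighborhood_image_eq_iff[OF m E uv(2,4)] .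
  qed
qed

lemma relabel_invariant_semi_point_determining: "relabel_invariant semi_point_determining"
proof (rule relabel_invariantI)
  fix V and E :: "('a + 'b) set set" and m :: "'a + 'b \<Rightarrow> 'a + 'b"
  assume E: "E \<subseteq> Pow V" and m: "inj_on m V" and isl: "\<And>v. isl (m v) = isl v"
    and pd: "semi_point_determining V E"
  show "semi_point_determining (m ` V) (image m ` E)"
    unfolding semi_point_determining_def
  proof (intro ballI impI; elim imageE conjE)
    fix u' v' u v
    assume "u' \<noteq> v'" "isl u' = isl v'" and uv: "u' = m u" "u \<in> V" "v' = m v" "v \<in> V"
    then have "u \<noteq> v" "isl u = isl v" by (auto simp: isl)
    then have "neighborhood E u \<noteq> neighborhood E v"
      using pd uv(2,4) by (simp add: semi_point_determining_def)
    then show "neighborhood (image m ` E) u' \<noteq> neighborhood (image m ` E) v'"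
      unfolding uv(1,3) neighborhood_image_eq_iff[OF m E uv(2,4)] .
  qed
qed

lemma relabel_invariant_connected_graph: "relabel_invariant connected_graph"
proof (rule relabel_invariantI)
  fix V and E :: "('a + 'b) set set" and m :: "'a + 'b \<Rightarrow> 'a + 'b"
  assume conn: "connected_graph V E"
  have path: "(m u, m v) \<in> {(x, y). {x, y} \<in> image m ` E}\<^sup>*" if "(u, v) \<in> {(x, y). {x, y} \<in> E}\<^sup>*" for u v
    using that
  proof induction
    case (step y z)
    then have "{m y, m z} \<in> image m ` E" using imageI[of "{y, z}" E "image m"] by simp
    then have "(m y, m z) \<in> {(x, y). {x, y} \<in> image m ` E}" by simp
    with step.IH show ?case by (rule rtrancl_into_rtrancl)
  qed simp
  show "connected_graph (m ` V) (image m ` E)"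
    unfolding connected_graph_def
  proof (intro conjI ballI; (elim imageE)?)
    show "m ` V \<noteq> {}" using conn by (simp add: connected_graph_def)
    fix u' v' u v assume uv: "u' = m u" "u \<in> V" "v' = m v" "v \<in> V"
    show "(u', v') \<in> {(x, y). {x, y} \<in> image m ` E}\<^sup>*"
      using conn uv(2,4) unfolding uv(1,3) connected_graph_def by (intro path) simp
  qed
qed

lemma relabel_invariant_card: "relabel_invariant (\<lambda>V E. R (card V))"
  by (rule relabel_invariantI) (simp add: card_image)

definition isolated :: "'v set \<Rightarrow> 'v set set \<Rightarrow> 'v set" where
  "isolated V E = {v \<in> V. neighborhood E v = {}}"

lemma relabel_invariant_no_isolated: "relabel_invariant (\<lambda>V E. isolated V E = {})"
  by (rule relabel_invariantI) (auto simp: isolated_def neighborhood_image)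

lemma species_graph_species:
  fixes Q :: "('a + 'b) set \<Rightarrow> ('a + 'b) set set \<Rightarrow> bool"
  assumes Q: "relabel_invariant Q"
  shows "species (graph_species Q)"
proof (rule speciesI)
  fix U1 :: "'a set" and U2 :: "'b set"
  assume "finite U1" "finite U2"
  moreover have "structs (graph_species Q) U1 U2 \<subseteq> Pow (Pow (U1 <+> U2))"
    using bicolored_graphD(3) by (fastforce simp: graph_species_def)
  ultimately show "finite (structs (graph_species Q) U1 U2)"
    by (auto intro: finite_subset)
next
  fix U1 :: "'a set" and U2 :: "'b set" and \<sigma> :: "'a \<Rightarrow> 'a" and \<tau> :: "'b \<Rightarrow> 'b" and E
  assume *: "inj_on \<sigma> U1" "inj_on \<tau> U2" "E \<in> structs (graph_species Q) U1 U2"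
  then have E: "bicolored_graph U1 U2 E" "Q (U1 <+> U2) E"
    by (simp_all add: graph_species_def)
  show "transport (graph_species Q) U1 U2 \<sigma> \<tau> E \<in> structs (graph_species Q) (\<sigma> ` U1) (\<tau> ` U2)"
    using bicolored_graph_relabel[OF E(1) *(1,2)] Q[unfolded relabel_invariant_def, rule_format, OF E(1) *(1,2) E(2)]
    by (simp add: graph_species_def map_sum_image_Plus)
  show "transport (graph_species Q) U1 U2 \<sigma> \<tau> E = transport (graph_species Q) U1 U2 \<sigma>' \<tau>' E"
    if eq: "\<And>x. x \<in> U1 \<Longrightarrow> \<sigma> x = \<sigma>' x" "\<And>y. y \<in> U2 \<Longrightarrow> \<tau> y = \<tau>' y" for \<sigma>' \<tau>'
  proof -
    have "map_sum \<sigma> \<tau> v = map_sum \<sigma>' \<tau>' v" if "v \<in> U1 <+> U2" for v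
      using that eq by auto
    then have "map_sum \<sigma> \<tau> ` e = map_sum \<sigma>' \<tau>' ` e" if "e \<in> E" for e
      using bicolored_graphD(3)[OF E(1) that] by (intro image_cong refl) blast
    then have "image (map_sum \<sigma> \<tau>) ` E = image (map_sum \<sigma>' \<tau>') ` E"
      by (rule image_cong[OF refl])
    then show ?thesis by (simp add: graph_species_def)
  qed
  show "transport (graph_species Q) U1 U2 (\<sigma>' \<circ> \<sigma>) (\<tau>' \<circ> \<tau>) E =
    transport (graph_species Q) (\<sigma> ` U1) (\<tau> ` U2) \<sigma>' \<tau>' (transport (graph_species Q) U1 U2 \<sigma> \<tau> E)"
    for \<sigma>' \<tau>'
    by (simp add: graph_species_def map_sum.comp[symmetric]) (simp add: image_image comp_def)
qed (simp add: graph_species_def map_sum.id)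

section \<open>Splitting off the isolated vertices\<close>

text \<open>
  The part with an \<open>F\<close>-structure consists of the isolated vertices, so the edge set alone
  determines the decomposition; \<open>F\<close> only says how many isolated vertices of each color there may be.
\<close>

lemma graph_species_split_isolated:
  fixes F :: "('a, 'b, 's) species2" and P Q :: "('a + 'b) set \<Rightarrow> ('a + 'b) set set \<Rightarrow> bool"
  assumes F: "species F" and P: "relabel_invariant P" and Q: "relabel_invariant Q"
    and unique: "\<And>A1 A2 s t. \<lbrakk>s \<in> structs F A1 A2; t \<in> structs F A1 A2\<rbrakk> \<Longrightarrow> s = t"
    and split: "\<And>U1 U2 E. bicolored_graph U1 U2 E \<Longrightarrow> Q (U1 <+> U2) E \<longleftrightarrow>
      structs F (Inl -` isolated (U1 <+> U2) E) (Inr -` isolated (U1 <+> U2) E) \<noteq> {} \<and>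
      P ((U1 <+> U2) - isolated (U1 <+> U2) E) E"
  shows "F *\<^sub>s graph_species (\<lambda>V E. P V E \<and> isolated V E = {}) \<cong>\<^sub>s graph_species Q"
proof -
  let ?N = "graph_species (\<lambda>V E. P V E \<and> isolated V E = {})"
  let ?\<eta> = "\<lambda>(U1 :: 'a set) (U2 :: 'b set) ((A1 :: 'a set, A2 :: 'b set, s :: 's), (B1 :: 'a set, B2 :: 'b set, E :: ('a + 'b) set set)). E"
  let ?I = "\<lambda>U1 U2 E. isolated (U1 <+> U2) E"
  let ?\<theta> = "\<lambda>U1 U2 E. let I1 = Inl -` ?I U1 U2 E; I2 = Inr -` ?I U1 U2 E in
     ((I1, I2, SOME s. s \<in> structs F I1 I2), (U1 - I1, U2 - I2, E))"
  have N: "species ?N"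
    by (intro species_graph_species relabel_invariant_conj P relabel_invariant_no_isolated)
  show ?thesis
  proof (rule species_isoI[where \<eta> = ?\<eta>])
    show "species (F *\<^sub>s ?N)" by (rule species_prod[OF F N])
    show "species (graph_species Q)" by (rule species_graph_species[OF Q])
    fix U1 :: "'a set" and U2 :: "'b set"
    assume fin: "finite U1" "finite U2"
    have prod: "bicolored_graph U1 U2 E \<and> Q (U1 <+> U2) E \<and> ?I U1 U2 E = A1 <+> A2"
      if dec: "A1 \<union> B1 = U1" "A1 \<inter> B1 = {}" "A2 \<union> B2 = U2" "A2 \<inter> B2 = {}"
        and s: "s \<in> structs F A1 A2" and E: "E \<in> structs ?N B1 B2"
      for A1 A2 B1 B2 s E
    proof -
      have E': "bicolored_graph B1 B2 E" "P (B1 <+> B2) E" "isolated (B1 <+> B2) E = {}"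
        using E by (simp_all add: graph_species_def)
      have sub: "B1 <+> B2 \<subseteq> U1 <+> U2" using dec by blast
      have bi: "bicolored_graph U1 U2 E"
      proof -
        have "e \<subseteq> U1 <+> U2" if "e \<in> E" for e
          using bicolored_graphD(3)[OF E'(1) that] sub by (rule subset_trans)
        then show ?thesis
          using bicolored_graphD(4,5)[OF E'(1)] fin
          by (simp add: bicolored_graph_def simple_graph_def)
      qed
      have "v \<notin> B1 <+> B2" if "v \<in> A1 <+> A2" for v
        using dec that by auto
      then have nbA: "neighborhood E v = {}" if "v \<in> A1 <+> A2" for v
        using bicolored_graphD(6)[OF E'(1)] that unfolding neighborhood_def by blast
      have nbB: "neighborhood E v \<noteq> {}" if "v \<in> B1 <+> B2" for v
        using E'(3) that unfolding isolated_def by blast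
      have U: "U1 <+> U2 = (A1 <+> A2) \<union> (B1 <+> B2)" "(A1 <+> A2) \<inter> (B1 <+> B2) = {}"
        using dec by auto
      have I: "?I U1 U2 E = A1 <+> A2"
        using nbA nbB unfolding isolated_def U(1) by blast
      have "(U1 <+> U2) - (A1 <+> A2) = B1 <+> B2" using U by blast
      moreover have "Inl -` (A1 <+> A2) = A1" "Inr -` (A1 <+> A2) = A2" by auto
      ultimately have "Q (U1 <+> U2) E"
        unfolding split[OF bi] I using s E'(2) by auto
      with bi I show ?thesis by simp
    qed
    show "bij_betw (?\<eta> U1 U2) (structs (F *\<^sub>s ?N) U1 U2) (structs (graph_species Q) U1 U2)"
    proof (rule bij_betw_byWitness[where f' = "?\<theta> U1 U2"])
      show "\<forall>p\<in>structs (F *\<^sub>s ?N) U1 U2. ?\<theta> U1 U2 (?\<eta> U1 U2 p) = p"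
      proof
        fix p assume "p \<in> structs (F *\<^sub>s ?N) U1 U2"
        then obtain A1 A2 s B1 B2 E where p: "p = ((A1, A2, s), (B1, B2, E))"
          and dec: "A1 \<union> B1 = U1" "A1 \<inter> B1 = {}" "A2 \<union> B2 = U2" "A2 \<inter> B2 = {}"
          and s: "s \<in> structs F A1 A2" and E: "E \<in> structs ?N B1 B2"
          by (auto simp: species_prod_def)
        have "?I U1 U2 E = A1 <+> A2" using prod[OF dec s E] by simp
        then have I: "Inl -` ?I U1 U2 E = A1" "Inr -` ?I U1 U2 E = A2" by auto
        have "(SOME s. s \<in> structs F A1 A2) = s"
          using s unique by (metis someI)
        moreover have "U1 - A1 = B1" "U2 - A2 = B2" using dec by auto
        ultimately show "?\<theta> U1 U2 (?\<eta> U1 U2 p) = p" by (simp add: p I)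
      qed
      show "\<forall>E\<in>structs (graph_species Q) U1 U2. ?\<eta> U1 U2 (?\<theta> U1 U2 E) = E"
        by (simp add: Let_def)
      show "?\<eta> U1 U2 ` structs (F *\<^sub>s ?N) U1 U2 \<subseteq> structs (graph_species Q) U1 U2"
        using prod by (auto simp: species_prod_def graph_species_def[of Q])
      show "?\<theta> U1 U2 ` structs (graph_species Q) U1 U2 \<subseteq> structs (F *\<^sub>s ?N) U1 U2"
      proof (rule image_subsetI)
        fix E assume "E \<in> structs (graph_species Q) U1 U2"
        then have E: "bicolored_graph U1 U2 E" "Q (U1 <+> U2) E"
          by (simp_all add: graph_species_def)
        define I1 where "I1 = Inl -` ?I U1 U2 E"
        define I2 where "I2 = Inr -` ?I U1 U2 E"
        have I: "?I U1 U2 E = I1 <+> I2" by (simp add: I1_def I2_def)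
        have Q': "structs F I1 I2 \<noteq> {}" "P ((U1 <+> U2) - ?I U1 U2 E) E"
          using E(2) unfolding split[OF E(1)] I1_def I2_def by auto
        have some: "(SOME s. s \<in> structs F I1 I2) \<in> structs F I1 I2"
          using Q'(1) by (simp add: some_in_eq)
        have "?I U1 U2 E \<subseteq> U1 <+> U2" by (auto simp: isolated_def)
        then have sub: "I1 \<subseteq> U1" "I2 \<subseteq> U2" by (auto simp: I1_def I2_def)
        have V: "(U1 <+> U2) - ?I U1 U2 E = (U1 - I1) <+> (U2 - I2)"
          unfolding I by auto
        have nb: "v \<in> (U1 <+> U2) - ?I U1 U2 E" if "{v, w} \<in> E" for v w
          using bicolored_graphD(6)[OF E(1) that] that unfolding isolated_def neighborhood_def by blast
        have "e \<subseteq> (U1 <+> U2) - ?I U1 U2 E" if e: "e \<in> E" for e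
        proof -
          from E(1) e obtain u v where uv: "e = {u, v}" by (rule bicolored_graph_edgeE)
          then have "{u, v} \<in> E" "{v, u} \<in> E" using e by (simp_all add: insert_commute)
          then show ?thesis unfolding uv using nb by blast
        qed
        then have "bicolored_graph (U1 - I1) (U2 - I2) E"
          using E(1) unfolding bicolored_graph_def simple_graph_def V by simp
        moreover have "isolated ((U1 <+> U2) - ?I U1 U2 E) E = {}"
          unfolding isolated_def by blast
        ultimately have "E \<in> structs ?N (U1 - I1) (U2 - I2)"
          using Q'(2) by (simp add: graph_species_def V)
        then show "?\<theta> U1 U2 E \<in> structs (F *\<^sub>s ?N) U1 U2"
          using some sub unfolding I1_def[symmetric] I2_def[symmetric] Let_def
          by (auto simp: species_prod_def)
      qed
    qed
  next
    fix U1 :: "'a set" and U2 :: "'b set" and \<sigma> :: "'a \<Rightarrow> 'a" and \<tau> :: "'b \<Rightarrow> 'b" and p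
    assume "p \<in> structs (F *\<^sub>s ?N) U1 U2"
    then show "?\<eta> (\<sigma> ` U1) (\<tau> ` U2) (transport (F *\<^sub>s ?N) U1 U2 \<sigma> \<tau> p)
        = transport (graph_species Q) U1 U2 \<sigma> \<tau> (?\<eta> U1 U2 p)"
      by (cases p) (simp add: species_prod_def graph_species_def split: prod.splits)
  qed
qed


section \<open>Connected components\<close>

definition component :: "'v set set \<Rightarrow> 'v \<Rightarrow> 'v set" where
  "component E v = {(x, y). {x, y} \<in> E}\<^sup>* `` {v}"

definition components :: "'v set \<Rightarrow> 'v set set \<Rightarrow> 'v set set" where
  "components V E = component E ` V"

definition induced :: "'v set set \<Rightarrow> 'v set \<Rightarrow> 'v set set" where
  "induced E B = {e \<in> E. e \<subseteq> B}"

lemma mem_component [simp]: "v \<in> component E v"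
  by (simp add: component_def)

lemma component_step:
  assumes "x \<in> component E v" "{x, y} \<in> E"
  shows "y \<in> component E v"
  using assms by (auto simp: component_def intro: rtrancl_into_rtrancl)

lemma component_eq:
  assumes "w \<in> component E v"
  shows "component E w = component E v"
proof -
  let ?r = "{(x, y). {x, y} \<in> E}"
  have "sym ?r" by (rule symI) (simp add: insert_commute)
  then have "sym (?r\<^sup>*)" by (rule sym_rtrancl)
  moreover have vw: "(v, w) \<in> ?r\<^sup>*" using assms by (simp add: component_def)
  ultimately have wv: "(w, v) \<in> ?r\<^sup>*" by (blast dest: symD)
  show ?thesis
    unfolding component_def using rtrancl_trans[OF vw] rtrancl_trans[OF wv] by blast
qed

lemma component_subset:
  assumes "v \<in> B" and closed: "\<And>x y. \<lbrakk>x \<in> B; {x, y} \<in> E\<rbrakk> \<Longrightarrow> y \<in> B"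
  shows "component E v \<subseteq> B"
proof
  fix w assume "w \<in> component E v"
  then have "(v, w) \<in> {(x, y). {x, y} \<in> E}\<^sup>*" by (simp add: component_def)
  then show "w \<in> B"
    by induction (use assms(1) closed in auto)
qed

lemma partition_on_components:
  assumes "\<And>v. v \<in> V \<Longrightarrow> component E v \<subseteq> V"
  shows "partition_on V (components V E)"
proof (rule partition_onI)
  show "\<Union> (components V E) = V"
    using assms unfolding components_def by (auto intro: mem_component)
  show "{} \<notin> components V E"
    unfolding components_def using mem_component by (metis empty_iff imageE)
  fix p q assume "p \<in> components V E" "q \<in> components V E" "p \<noteq> q"
  then obtain u v where uv: "p = component E u" "q = component E v" "p \<noteq> q"
    by (auto simp: components_def)
  have False if "w \<in> p" "w \<in> q" for w
    using component_eq[of w E u] component_eq[of w E v] that uv by simp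
  then show "disjnt p q" by (auto simp: disjnt_def)
qed

text \<open>
  Every vertex reached by a path that starts in a component belongs to that component, so all
  edges of the path are edges of the induced graph.
\<close>

lemma connected_graph_component: "connected_graph (component E v) (induced E (component E v))"
proof -
  let ?B = "component E v"
  let ?r = "{(x, y). {x, y} \<in> induced E ?B}"
  have "(u, w) \<in> ?r\<^sup>*" if u: "u \<in> ?B" and w: "w \<in> ?B" for u w
  proof -
    have "(u, w) \<in> {(x, y). {x, y} \<in> E}\<^sup>*"
      using w component_eq[OF u] by (auto simp: component_def)
    then show ?thesis
    proof induction
      case (step y z)
      have "y \<in> component E u"
        using step.hyps(1) by (simp add: component_def)
      then have "y \<in> ?B" using component_eq[OF u] by simp
      moreover have "{y, z} \<in> E" using step.hyps(2) by simp
      ultimately have "(y, z) \<in> ?r"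
        using component_step by (fastforce simp: induced_def)
      with step.IH show ?case by (rule rtrancl_into_rtrancl)
    qed simp
  qed
  then show ?thesis
    unfolding connected_graph_def using mem_component by (metis empty_iff)
qed

lemma neighborhood_induced_component:
  assumes "v \<in> component E u"
  shows "neighborhood (induced E (component E u)) v = neighborhood E v"
proof -
  have "{v, w} \<subseteq> component E u" if "{v, w} \<in> E" for w
    using component_step[OF assms that] assms by simp
  then show ?thesis by (auto simp: neighborhood_def induced_def)
qed

lemma bicolored_graph_component:
  assumes E: "bicolored_graph U1 U2 E" and v: "v \<in> U1 <+> U2"
  shows "component E v \<subseteq> U1 <+> U2"
    "bicolored_graph (Inl -` component E v) (Inr -` component E v) (induced E (component E v))"
proof -
  show sub: "component E v \<subseteq> U1 <+> U2"
    by (rule component_subset[OF v]) (rule bicolored_graphD(7)[OF E])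
  have "finite (component E v)"
    using finite_subset[OF sub] bicolored_graphD(1,2)[OF E] by simp
  then show "bicolored_graph (Inl -` component E v) (Inr -` component E v) (induced E (component E v))"
    using bicolored_graphD(4,5)[OF E]
    by (simp add: bicolored_graph_def simple_graph_def induced_def)
qed

section \<open>Graphs as sets of connected graphs\<close>

text \<open>
  The union of connected graphs on the blocks of a partition has exactly these blocks as components,
  and the graph on a block is the one induced by the union. Hence a partition with connected graphs
  on its blocks carries the same information as the union of their edge sets.
\<close>

lemma species_components:
  fixes P Q :: "('a + 'b) set \<Rightarrow> ('a + 'b) set set \<Rightarrow> bool"
  assumes P: "relabel_invariant P" and Q: "relabel_invariant Q"
    and componentwise: "\<And>U1 U2 E. bicolored_graph U1 U2 E \<Longrightarrow>
      Q (U1 <+> U2) E \<longleftrightarrow> (\<forall>B \<in> components (U1 <+> U2) E. P B (induced E B))"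
  shows "E_comp (graph_species (\<lambda>V E. connected_graph V E \<and> P V E)) \<cong>\<^sub>s graph_species Q"
proof -
  let ?C = "graph_species (\<lambda>V E. connected_graph V E \<and> P V E)"
  let ?\<eta> = "\<lambda>(U1 :: 'a set) (U2 :: 'b set) (\<pi> :: ('a + 'b) set set, f :: ('a + 'b) set \<Rightarrow> ('a + 'b) set set). \<Union>B\<in>\<pi>. f B"
  let ?\<theta> = "\<lambda>U1 U2 E. (components (U1 <+> U2) E, \<lambda>B\<in>components (U1 <+> U2) E. induced E B)"
  have C: "species ?C"
    by (intro species_graph_species relabel_invariant_conj relabel_invariant_connected_graph P)
  have union: "bicolored_graph U1 U2 E \<and> Q (U1 <+> U2) E \<and> ?\<theta> U1 U2 E = (\<pi>, f)"
    if fin: "finite U1" "finite U2" and st: "(\<pi>, f) \<in> structs (E_comp ?C) U1 U2"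
      and E: "E = (\<Union>B\<in>\<pi>. f B)" for U1 U2 \<pi> f E
  proof -
    have part: "partition_on (U1 <+> U2) \<pi>" and ext: "f \<in> extensional \<pi>"
      using st by (auto simp: E_comp_def PiE_def)
    have sub: "B \<subseteq> U1 <+> U2" if "B \<in> \<pi>" for B
      by (rule E_comp_block(1)[OF st that])
    have block: "bicolored_graph (Inl -` B) (Inr -` B) (f B)" "connected_graph B (f B)" "P B (f B)"
      if "B \<in> \<pi>" for B
      using E_comp_block(4)[OF st that] by (simp_all add: graph_species_def)
    have edge: "e \<subseteq> B" "card e = 2" if "B \<in> \<pi>" "e \<in> f B" for e B
      using bicolored_graphD(3,4)[OF block(1)[OF that(1)] that(2)] by simp_all
    have bi: "bicolored_graph U1 U2 E"
    proof -
      have "e \<subseteq> U1 <+> U2 \<and> card e = 2" if "e \<in> E" for e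
        using that edge sub unfolding E by blast
      moreover have "isl u \<noteq> isl v" if "{u, v} \<in> E" for u v
        using that bicolored_graphD(5)[OF block(1)] unfolding E by blast
      ultimately show ?thesis
        using fin by (simp add: bicolored_graph_def simple_graph_def)
    qed
    have same: "B = B'" if "B \<in> \<pi>" "B' \<in> \<pi>" "x \<in> B" "x \<in> B'" for B B' x
      using partition_onD2[OF part] that by (auto simp: disjoint_def)
    have ind: "induced E B = f B" if B: "B \<in> \<pi>" for B
    proof (intro equalityI subsetI)
      fix e assume "e \<in> induced E B"
      then obtain B' where B': "B' \<in> \<pi>" "e \<in> f B'" "e \<subseteq> B"
        by (auto simp: induced_def E)
      have "e \<noteq> {}" using edge(2)[OF B'(1,2)] by auto
      then have "B = B'" using same[OF B B'(1)] B'(3) edge(1)[OF B'(1,2)] by blast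
      then show "e \<in> f B" using B'(2) by simp
    qed (use edge(1)[OF B] B in \<open>auto simp: induced_def E\<close>)
    have comp: "component E x = B" if B: "B \<in> \<pi>" and x: "x \<in> B" for B x
    proof
      show "component E x \<subseteq> B"
      proof (rule component_subset[OF x])
        fix y z assume yz: "y \<in> B" "{y, z} \<in> E"
        then obtain B' where B': "B' \<in> \<pi>" "{y, z} \<in> f B'" by (auto simp: E)
        have "{y, z} \<subseteq> B'" by (rule edge(1)[OF B'])
        with same[OF B B'(1), of y] yz(1) show "z \<in> B" by simp
      qed
      show "B \<subseteq> component E x"
      proof
        fix y assume "y \<in> B"
        then have "(x, y) \<in> {(x, y). {x, y} \<in> f B}\<^sup>*"
          using block(2)[OF B] x by (simp add: connected_graph_def)
        moreover have "{(x, y). {x, y} \<in> f B} \<subseteq> {(x, y). {x, y} \<in> E}"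
          using B by (auto simp: E)
        ultimately show "y \<in> component E x"
          unfolding component_def using rtrancl_mono by blast
      qed
    qed
    have comps: "components (U1 <+> U2) E = \<pi>"
    proof (intro equalityI subsetI)
      fix B assume "B \<in> components (U1 <+> U2) E"
      then obtain x where x: "x \<in> U1 <+> U2" "B = component E x"
        by (auto simp: components_def)
      then obtain B' where "B' \<in> \<pi>" "x \<in> B'" using partition_onD1[OF part] by blast
      then show "B \<in> \<pi>" using comp x(2) by simp
    next
      fix B assume B: "B \<in> \<pi>"
      then obtain x where x: "x \<in> B" using partition_onD3[OF part] by (metis all_not_in_conv)
      then have "B = component E x" using comp[OF B] by simp
      then show "B \<in> components (U1 <+> U2) E"
        using sub[OF B] x unfolding components_def by blast
    qed
    have "(\<lambda>B\<in>\<pi>. induced E B) = f"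
      using ext by (intro extensionalityI) (auto simp: ind)
    moreover have "Q (U1 <+> U2) E"
      unfolding componentwise[OF bi] comps using ind block(3) by simp
    ultimately show ?thesis using bi by (simp add: comps)
  qed
  show ?thesis
  proof (rule species_isoI[where \<eta> = ?\<eta>])
    show "species (E_comp ?C)" by (rule species_E_comp[OF C])
    show "species (graph_species Q)" by (rule species_graph_species[OF Q])
    fix U1 :: "'a set" and U2 :: "'b set"
    assume fin: "finite U1" "finite U2"
    show "bij_betw (?\<eta> U1 U2) (structs (E_comp ?C) U1 U2) (structs (graph_species Q) U1 U2)"
    proof (rule bij_betw_byWitness[where f' = "?\<theta> U1 U2"])
      show "\<forall>p\<in>structs (E_comp ?C) U1 U2. ?\<theta> U1 U2 (?\<eta> U1 U2 p) = p"
      proof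
        fix p assume "p \<in> structs (E_comp ?C) U1 U2"
        moreover obtain \<pi> f where p: "p = (\<pi>, f)" by (cases p)
        ultimately have "(\<pi>, f) \<in> structs (E_comp ?C) U1 U2" by simp
        from union[OF fin this refl] show "?\<theta> U1 U2 (?\<eta> U1 U2 p) = p"
          unfolding p prod.case by blast
      qed
      show "?\<eta> U1 U2 ` structs (E_comp ?C) U1 U2 \<subseteq> structs (graph_species Q) U1 U2"
      proof (rule image_subsetI)
        fix p assume "p \<in> structs (E_comp ?C) U1 U2"
        then show "?\<eta> U1 U2 p \<in> structs (graph_species Q) U1 U2"
          using union[OF fin _ refl] by (cases p) (simp add: graph_species_def[of Q])
      qed
      have graph: "?\<eta> U1 U2 (?\<theta> U1 U2 E) = E \<and> ?\<theta> U1 U2 E \<in> structs (E_comp ?C) U1 U2"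
        if "E \<in> structs (graph_species Q) U1 U2" for E
      proof
        have E: "bicolored_graph U1 U2 E" "Q (U1 <+> U2) E"
          using that by (simp_all add: graph_species_def)
        have "e \<in> (\<Union>B\<in>components (U1 <+> U2) E. induced E B)" if e: "e \<in> E" for e
        proof -
          from E(1) e obtain u v where uv: "e = {u, v}" by (rule bicolored_graph_edgeE)
          have "v \<in> component E u"
            by (rule component_step[OF mem_component]) (use e uv in simp)
          then have "e \<in> induced E (component E u)"
            using e uv by (simp add: induced_def)
          moreover have "u \<in> U1 <+> U2" using bicolored_graphD(6)[OF E(1)] e uv by simp
          ultimately show ?thesis unfolding components_def by blast
        qed
        then have "(\<Union>B\<in>components (U1 <+> U2) E. induced E B) = E"
          by (auto simp: induced_def)
        then show "?\<eta> U1 U2 (?\<theta> U1 U2 E) = E" by simp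
        have "induced E B \<in> structs ?C (Inl -` B) (Inr -` B)" if B: "B \<in> components (U1 <+> U2) E" for B
        proof -
          from B obtain v where v: "v \<in> U1 <+> U2" "B = component E v"
            by (auto simp: components_def)
          have "P B (induced E B)" using E(2) B unfolding componentwise[OF E(1)] by blast
          then show ?thesis
            using bicolored_graph_component(2)[OF E(1) v(1)] connected_graph_component[of E v]
            by (simp add: graph_species_def v(2))
        qed
        moreover have "partition_on (U1 <+> U2) (components (U1 <+> U2) E)"
          by (rule partition_on_components) (rule bicolored_graph_component(1)[OF E(1)])
        ultimately show "?\<theta> U1 U2 E \<in> structs (E_comp ?C) U1 U2"
          by (simp add: E_comp_def)
      qed
      show "\<forall>E\<in>structs (graph_species Q) U1 U2. ?\<eta> U1 U2 (?\<theta> U1 U2 E) = E"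
        using graph by blast
      show "?\<theta> U1 U2 ` structs (graph_species Q) U1 U2 \<subseteq> structs (E_comp ?C) U1 U2"
        using graph by blast
    qed
  next
    fix U1 :: "'a set" and U2 :: "'b set" and \<sigma> :: "'a \<Rightarrow> 'a" and \<tau> :: "'b \<Rightarrow> 'b" and p
    assume inj: "inj_on \<sigma> U1" "inj_on \<tau> U2" and "p \<in> structs (E_comp ?C) U1 U2"
    moreover obtain \<pi> f where p: "p = (\<pi>, f)" by (cases p)
    ultimately have st: "(\<pi>, f) \<in> structs (E_comp ?C) U1 U2" by simp
    let ?m = "map_sum \<sigma> \<tau>"
    obtain f' where tr: "transport (E_comp ?C) U1 U2 \<sigma> \<tau> (\<pi>, f) = (image ?m ` \<pi>, f')"
      by (auto simp: E_comp_def)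
    have f': "f' (?m ` B) = image ?m ` f B" if "B \<in> \<pi>" for B
      using E_comp_transport_block[OF st inj that] tr by (simp add: graph_species_def)
    have "(\<Union>C\<in>image ?m ` \<pi>. f' C) = image ?m ` (\<Union>B\<in>\<pi>. f B)"
      by (simp add: f' image_UN)
    then show "?\<eta> (\<sigma> ` U1) (\<tau> ` U2) (transport (E_comp ?C) U1 U2 \<sigma> \<tau> p)
        = transport (graph_species Q) U1 U2 \<sigma> \<tau> (?\<eta> U1 U2 p)"
      by (simp add: p tr graph_species_def[of Q])
  qed
qed


section \<open>Point-determining graphs and their isolated vertices\<close>

lemma at_least_two_graph_species:
  "at_least_two (graph_species P) = graph_species (\<lambda>V E. P V E \<and> 2 \<le> card V)"
proof -
  have card: "card (U1 <+> U2) = card U1 + card U2" if "bicolored_graph U1 U2 E"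
    for U1 :: "'a set" and U2 :: "'b set" and E
    using bicolored_graphD(1,2)[OF that] by (rule card_Plus)
  have "structs (at_least_two (graph_species P)) = structs (graph_species (\<lambda>V E. P V E \<and> 2 \<le> card V))"
    by (intro ext) (auto simp: at_least_two_def graph_species_def card)
  then show ?thesis by (simp add: at_least_two_def graph_species_def)
qed

lemma neighborhood_eq_imp_same_color:
  assumes E: "bicolored_graph U1 U2 E" and eq: "neighborhood E u = neighborhood E v"
    and ne: "neighborhood E u \<noteq> {}"
  shows "isl u = isl v"
proof -
  from ne obtain w where w: "{u, w} \<in> E" by (auto simp: neighborhood_def)
  with eq have "{v, w} \<in> E" by (auto simp: neighborhood_def)
  then show ?thesis using bicolored_graphD(5)[OF E] w by blast
qed

text \<open>
  A component has at least two vertices exactly if none of its vertices is isolated. Neighborhoods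
  in a component are the same as in the whole graph, and vertices in different components can only
  share the empty neighborhood.
\<close>

lemma point_determining_components:
  assumes E: "bicolored_graph U1 U2 E"
  shows "point_determining (U1 <+> U2) E \<and> isolated (U1 <+> U2) E = {} \<longleftrightarrow>
    (\<forall>B \<in> components (U1 <+> U2) E. point_determining B (induced E B) \<and> 2 \<le> card B)"
    (is "?L \<longleftrightarrow> ?R")
proof
  assume L: ?L
  show ?R
  proof
    fix B assume "B \<in> components (U1 <+> U2) E"
    then obtain x where x: "x \<in> U1 <+> U2" and B: "B = component E x"
      by (auto simp: components_def)
    have sub: "B \<subseteq> U1 <+> U2" unfolding B by (rule bicolored_graph_component(1)[OF E x])
    have nb: "neighborhood (induced E B) v = neighborhood E v" if "v \<in> B" for v
      using that unfolding B by (rule neighborhood_induced_component)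
    have "point_determining B (induced E B)"
      unfolding point_determining_def
    proof (intro ballI impI)
      fix u v assume uv: "u \<in> B" "v \<in> B" "u \<noteq> v"
      then have "neighborhood E u \<noteq> neighborhood E v"
        using L sub unfolding point_determining_def by blast
      then show "neighborhood (induced E B) u \<noteq> neighborhood (induced E B) v"
        by (simp add: nb uv)
    qed
    moreover have "2 \<le> card B"
    proof -
      have "neighborhood E x \<noteq> {}" using L x unfolding isolated_def by blast
      then obtain y where y: "{x, y} \<in> E" by (auto simp: neighborhood_def)
      then have "x \<noteq> y" using bicolored_graphD(5)[OF E] by blast
      moreover have "{x, y} \<subseteq> B" unfolding B using component_step[OF mem_component y] by simp
      moreover have "finite B"
        using finite_subset[OF sub] bicolored_graphD(1,2)[OF E] by simp
      ultimately show ?thesis using card_mono[of B "{x, y}"] by simp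
    qed
    ultimately show "point_determining B (induced E B) \<and> 2 \<le> card B" by blast
  qed
next
  assume R: ?R
  have block: "point_determining (component E x) (induced E (component E x))"
    "2 \<le> card (component E x)" if "x \<in> U1 <+> U2" for x
    using R that by (auto simp: components_def)
  have nonempty: "neighborhood E x \<noteq> {}" if x: "x \<in> U1 <+> U2" for x
  proof
    assume "neighborhood E x = {}"
    then have "component E x \<subseteq> {x}"
      by (intro component_subset) (auto simp: neighborhood_def)
    then have "card (component E x) \<le> card {x}" by (intro card_mono) auto
    then show False using block(2)[OF x] by simp
  qed
  have "neighborhood E u \<noteq> neighborhood E v"
    if uv: "u \<in> U1 <+> U2" "v \<in> U1 <+> U2" "u \<noteq> v" for u v
  proof
    assume eq: "neighborhood E u = neighborhood E v"
    \<comment> \<open>A common neighbor puts both vertices into one component.\<close>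
    from nonempty[OF uv(1)] obtain w where w: "{u, w} \<in> E" by (auto simp: neighborhood_def)
    have "{w, v} \<in> E" using w eq by (auto simp: neighborhood_def insert_commute)
    with component_step[OF mem_component w] have v: "v \<in> component E u"
      by (rule component_step)
    then have "neighborhood (induced E (component E u)) u \<noteq> neighborhood (induced E (component E u)) v"
      using block(1)[OF uv(1)] uv(3) unfolding point_determining_def by simp
    then show False
      using eq v by (simp add: neighborhood_induced_component)
  qed
  with nonempty show ?L
    unfolding point_determining_def isolated_def by blast
qed

lemma no_isolated_iso_E_comp:
  "E_comp (at_least_two connected_PD :: ('a, 'b, ('a + 'b) set set) species2) \<cong>\<^sub>s
    graph_species (\<lambda>V E. point_determining V E \<and> isolated V E = {})"
proof -
  have "(at_least_two connected_PD :: ('a, 'b, ('a + 'b) set set) species2) =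
      graph_species (\<lambda>V E. connected_graph V E \<and> (point_determining V E \<and> 2 \<le> card V))"
    unfolding connected_PD_def at_least_two_graph_species conj_assoc ..
  then show ?thesis
    by (simp only:) (intro species_components point_determining_components relabel_invariant_conj
        relabel_invariant_point_determining relabel_invariant_no_isolated relabel_invariant_card)
qed

text \<open>
  The common shape of both identities: all that remains to be supplied for a class of graphs is the
  species \<open>F\<close> of its admissible sets of isolated vertices.
\<close>

lemma iso_isolated_times_E_comp:
  fixes F :: "('a, 'b, 's) species2" and Q :: "('a + 'b) set \<Rightarrow> ('a + 'b) set set \<Rightarrow> bool"
  assumes F: "species F" and Q: "relabel_invariant Q"
    and unique: "\<And>A1 A2 s t. \<lbrakk>s \<in> structs F A1 A2; t \<in> structs F A1 A2\<rbrakk> \<Longrightarrow> s = t"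
    and split: "\<And>U1 U2 E. bicolored_graph U1 U2 E \<Longrightarrow> Q (U1 <+> U2) E \<longleftrightarrow>
      structs F (Inl -` isolated (U1 <+> U2) E) (Inr -` isolated (U1 <+> U2) E) \<noteq> {} \<and>
      point_determining ((U1 <+> U2) - isolated (U1 <+> U2) E) E"
  shows "graph_species Q \<cong>\<^sub>s F *\<^sub>s E_comp (at_least_two connected_PD)"
proof (rule species_iso_trans)
  show "graph_species Q \<cong>\<^sub>s
      F *\<^sub>s graph_species (\<lambda>V E. point_determining V E \<and> isolated V E = {})"
    by (rule species_iso_sym, rule graph_species_split_isolated[OF F
          relabel_invariant_point_determining Q unique split])
  show "F *\<^sub>s graph_species (\<lambda>V E. point_determining V E \<and> isolated V E = {})
      \<cong>\<^sub>s F *\<^sub>s E_comp (at_least_two connected_PD)"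
    by (rule species_prod_cong_right[OF F species_iso_sym[OF no_isolated_iso_E_comp]])
qed

lemma point_determining_split_isolated:
  assumes E: "bicolored_graph U1 U2 E"
  shows "point_determining (U1 <+> U2) E \<longleftrightarrow>
    card (Inl -` isolated (U1 <+> U2) E) + card (Inr -` isolated (U1 <+> U2) E) \<le> 1 \<and>
    point_determining ((U1 <+> U2) - isolated (U1 <+> U2) E) E"
proof -
  let ?V = "U1 <+> U2" and ?I = "isolated (U1 <+> U2) E"
  have fin: "finite ?I"
    using bicolored_graphD(1,2)[OF E] by (simp add: isolated_def)
  have "card (Inl -` ?I) + card (Inr -` ?I) = card ((Inl -` ?I) <+> (Inr -` ?I))"
    using fin by (intro card_Plus[symmetric]) (auto intro: finite_vimageI)
  then have card: "card (Inl -` ?I) + card (Inr -` ?I) \<le> 1 \<longleftrightarrow> (\<forall>u\<in>?I. \<forall>v\<in>?I. u = v)"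
    using card_le_Suc0_iff_eq[OF fin] by simp
  have "neighborhood E u \<noteq> neighborhood E v" if "u \<in> ?I" "v \<in> ?V - ?I" for u v
    using that by (auto simp: isolated_def)
  moreover have "neighborhood E u = neighborhood E v" if "u \<in> ?I" "v \<in> ?I" for u v
    using that by (simp add: isolated_def)
  moreover have "?I \<subseteq> ?V" by (auto simp: isolated_def)
  ultimately show ?thesis
    unfolding card point_determining_def by (smt (verit, ccfv_threshold) Diff_iff subsetD)
qed

text \<open>
  Off the isolated vertices semi-point-determination is point-determination, since vertices of
  different colors cannot share a nonempty neighborhood.
\<close>

lemma semi_point_determining_split_isolated:
  assumes E: "bicolored_graph U1 U2 E"
  shows "semi_point_determining (U1 <+> U2) E \<longleftrightarrow>
    (card (Inl -` isolated (U1 <+> U2) E) \<le> 1 \<and> card (Inr -` isolated (U1 <+> U2) E) \<le> 1) \<and>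
    point_determining ((U1 <+> U2) - isolated (U1 <+> U2) E) E"
proof -
  let ?V = "U1 <+> U2" and ?I = "isolated (U1 <+> U2) E"
  have fin: "finite ?I"
    using bicolored_graphD(1,2)[OF E] by (simp add: isolated_def)
  have "card (Inl -` ?I) \<le> 1 \<longleftrightarrow> (\<forall>u\<in>Inl -` ?I. \<forall>v\<in>Inl -` ?I. u = v)"
    "card (Inr -` ?I) \<le> 1 \<longleftrightarrow> (\<forall>u\<in>Inr -` ?I. \<forall>v\<in>Inr -` ?I. u = v)"
    using fin by (simp_all add: card_le_Suc0_iff_eq finite_vimageI)
  moreover have "(\<forall>u\<in>?I. \<forall>v\<in>?I. isl u = isl v \<longrightarrow> u = v) \<longleftrightarrow>
      (\<forall>u\<in>Inl -` ?I. \<forall>v\<in>Inl -` ?I. u = v) \<and> (\<forall>u\<in>Inr -` ?I. \<forall>v\<in>Inr -` ?I. u = v)"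
    (is "?A \<longleftrightarrow> ?B")
  proof
    assume A: ?A
    show ?B using A[rule_format, of "Inl _" "Inl _"] A[rule_format, of "Inr _" "Inr _"] by simp
  next
    assume B: ?B
    show ?A
    proof (intro ballI impI)
      fix u v assume "u \<in> ?I" "v \<in> ?I" "isl u = isl v"
      then show "u = v" using B by (cases u; cases v) auto
    qed
  qed
  ultimately have card: "card (Inl -` ?I) \<le> 1 \<and> card (Inr -` ?I) \<le> 1 \<longleftrightarrow>
      (\<forall>u\<in>?I. \<forall>v\<in>?I. isl u = isl v \<longrightarrow> u = v)"
    by blast
  have "neighborhood E u \<noteq> neighborhood E v" if "u \<in> ?I" "v \<in> ?V - ?I" for u v
    using that by (auto simp: isolated_def)
  moreover have "neighborhood E u = neighborhood E v" if "u \<in> ?I" "v \<in> ?I" for u v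
    using that by (simp add: isolated_def)
  moreover have "?I \<subseteq> ?V" by (auto simp: isolated_def)
  moreover have "isl u = isl v" if "u \<in> ?V - ?I" "neighborhood E u = neighborhood E v" for u v
    using neighborhood_eq_imp_same_color[OF E that(2)] that(1) by (simp add: isolated_def)
  ultimately show ?thesis
    unfolding card point_determining_def semi_point_determining_def
    by (smt (verit, ccfv_threshold) Diff_iff subsetD)
qed

lemma structs_One_plus_X: "s \<in> structs (One +\<^sub>s Sort_X) A1 A2 \<longleftrightarrow>
    A2 = {} \<and> ((A1 = {} \<and> s = Inl ()) \<or> (card A1 = 1 \<and> s = Inr ()))"
  by (auto simp: species_sum_def One_def Sort_X_def split: if_splits)

lemma structs_One_plus_Y: "s \<in> structs (One +\<^sub>s Sort_Y) A1 A2 \<longleftrightarrow>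
    A1 = {} \<and> ((A2 = {} \<and> s = Inl ()) \<or> (card A2 = 1 \<and> s = Inr ()))"
  by (auto simp: species_sum_def One_def Sort_Y_def split: if_splits)

lemma structs_One_plus_X_plus_Y: "s \<in> structs (One +\<^sub>s Sort_X +\<^sub>s Sort_Y) A1 A2 \<longleftrightarrow>
    (A1 = {} \<and> A2 = {} \<and> s = Inl (Inl ())) \<or> (card A1 = 1 \<and> A2 = {} \<and> s = Inl (Inr ())) \<or>
    (A1 = {} \<and> card A2 = 1 \<and> s = Inr ())"
  by (auto simp: species_sum_def One_def Sort_X_def Sort_Y_def split: if_splits)

text \<open>
  All white vertices must be in the first factor and all black ones in the second, so that there is
  at most one structure on each pair of sets.
  The types of the empty sets are given because the structures themselves do not determine them.
\<close>

lemma structs_One_plus_X_times_One_plus_Y: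
  fixes A1 :: "'a set" and A2 :: "'b set"
  shows
  "structs ((One +\<^sub>s Sort_X) *\<^sub>s (One +\<^sub>s Sort_Y)) A1 A2 =
    (\<lambda>(s, t). ((A1, {}, s), ({}, A2, t))) `
      (structs (One +\<^sub>s Sort_X) A1 ({} :: 'b set) \<times> structs (One +\<^sub>s Sort_Y) ({} :: 'a set) A2)"
  (is "?L = ?R")
proof (intro equalityI subsetI)
  fix p assume "p \<in> ?L"
  then obtain C1 C2 s D1 D2 t where p: "p = ((C1, C2, s), (D1, D2, t))"
    and dec: "C1 \<union> D1 = A1" "C2 \<union> D2 = A2"
    and st: "s \<in> structs (One +\<^sub>s Sort_X) C1 C2" "t \<in> structs (One +\<^sub>s Sort_Y) D1 D2"
    by (auto simp: species_prod_def)
  have empty: "C2 = {}" "D1 = {}"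
    using st by (simp_all add: structs_One_plus_X structs_One_plus_Y)
  with dec have "C1 = A1" "D2 = A2" by simp_all
  with st empty show "p \<in> ?R"
    unfolding p by (intro rev_image_eqI[of "(s, t)"]) simp_all
qed (auto simp: species_prod_def)

lemma semi_PD_iso:
  "semi_PD \<cong>\<^sub>s (One +\<^sub>s Sort_X) *\<^sub>s (One +\<^sub>s Sort_Y) *\<^sub>s E_comp (at_least_two connected_PD)"
  unfolding semi_PD_def
proof (rule iso_isolated_times_E_comp)
  show "species ((One +\<^sub>s Sort_X) *\<^sub>s (One +\<^sub>s Sort_Y))"
    by (intro species_prod species_sum species_One species_Sort_X species_Sort_Y)
  show "relabel_invariant semi_point_determining"
    by (rule relabel_invariant_semi_point_determining)
  show "s = t" if "s \<in> structs ((One +\<^sub>s Sort_X) *\<^sub>s (One +\<^sub>s Sort_Y)) A1 A2"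
    "t \<in> structs ((One +\<^sub>s Sort_X) *\<^sub>s (One +\<^sub>s Sort_Y)) A1 A2" for s t A1 A2
    using that unfolding structs_One_plus_X_times_One_plus_Y
    by (auto simp: structs_One_plus_X structs_One_plus_Y)
  fix U1 :: "'a set" and U2 :: "'b set" and E
  assume E: "bicolored_graph U1 U2 E"
  define I1 where "I1 = Inl -` isolated (U1 <+> U2) E"
  define I2 where "I2 = Inr -` isolated (U1 <+> U2) E"
  have "I1 \<subseteq> U1" "I2 \<subseteq> U2" by (auto simp: I1_def I2_def isolated_def)
  then have fin: "finite I1" "finite I2"
    using bicolored_graphD(1,2)[OF E] by (auto intro: finite_subset)
  have "structs ((One +\<^sub>s Sort_X) *\<^sub>s (One +\<^sub>s Sort_Y)) I1 I2 \<noteq> {} \<longleftrightarrow>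
      (I1 = {} \<or> card I1 = 1) \<and> (I2 = {} \<or> card I2 = 1)"
    unfolding structs_One_plus_X_times_One_plus_Y image_is_empty Times_empty
      ex_in_conv[symmetric] de_Morgan_disj structs_One_plus_X structs_One_plus_Y
    by auto
  also have "\<dots> \<longleftrightarrow> card I1 \<le> 1 \<and> card I2 \<le> 1"
    using fin by (auto simp: le_Suc_eq)
  finally show "semi_point_determining (U1 <+> U2) E \<longleftrightarrow>
      structs ((One +\<^sub>s Sort_X) *\<^sub>s (One +\<^sub>s Sort_Y)) (Inl -` isolated (U1 <+> U2) E)
        (Inr -` isolated (U1 <+> U2) E) \<noteq> {} \<and>
      point_determining ((U1 <+> U2) - isolated (U1 <+> U2) E) E"
    unfolding semi_point_determining_split_isolated[OF E] I1_def I2_def by simp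
qed

lemma PD_iso:
  "PD \<cong>\<^sub>s (One +\<^sub>s Sort_X +\<^sub>s Sort_Y) *\<^sub>s E_comp (at_least_two connected_PD)"
  unfolding PD_def
proof (rule iso_isolated_times_E_comp)
  show "species (One +\<^sub>s Sort_X +\<^sub>s Sort_Y)"
    by (intro species_sum species_One species_Sort_X species_Sort_Y)
  show "relabel_invariant point_determining"
    by (rule relabel_invariant_point_determining)
  show "s = t" if "s \<in> structs (One +\<^sub>s Sort_X +\<^sub>s Sort_Y) A1 A2"
    "t \<in> structs (One +\<^sub>s Sort_X +\<^sub>s Sort_Y) A1 A2" for s t A1 A2
    using that unfolding structs_One_plus_X_plus_Y by auto
  fix U1 :: "'a set" and U2 :: "'b set" and E
  assume E: "bicolored_graph U1 U2 E"
  define I1 where "I1 = Inl -` isolated (U1 <+> U2) E"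
  define I2 where "I2 = Inr -` isolated (U1 <+> U2) E"
  have "I1 \<subseteq> U1" "I2 \<subseteq> U2" by (auto simp: I1_def I2_def isolated_def)
  then have fin: "finite I1" "finite I2"
    using bicolored_graphD(1,2)[OF E] by (auto intro: finite_subset)
  have "structs (One +\<^sub>s Sort_X +\<^sub>s Sort_Y) I1 I2 \<noteq> {} \<longleftrightarrow>
      I1 = {} \<and> I2 = {} \<or> card I1 = 1 \<and> I2 = {} \<or> I1 = {} \<and> card I2 = 1"
    unfolding ex_in_conv[symmetric] structs_One_plus_X_plus_Y by auto
  also have "\<dots> \<longleftrightarrow> card I1 + card I2 \<le> 1"
    using fin by (auto simp: le_Suc_eq add_is_1)
  finally show "point_determining (U1 <+> U2) E \<longleftrightarrow>
      structs (One +\<^sub>s Sort_X +\<^sub>s Sort_Y) (Inl -` isolated (U1 <+> U2) E)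
        (Inr -` isolated (U1 <+> U2) E) \<noteq> {} \<and>
      point_determining ((U1 <+> U2) - isolated (U1 <+> U2) E) E"
    unfolding point_determining_split_isolated[OF E] I1_def I2_def by simp
qed

theorem theorem5p3:
  shows "((semi_PD :: ('a, 'b, ('a + 'b) set set) species2)
            \<cong>\<^sub>s (One +\<^sub>s Sort_X) *\<^sub>s (One +\<^sub>s Sort_Y) *\<^sub>s E_comp (at_least_two connected_PD)) \<and>
         ((PD :: ('a, 'b, ('a + 'b) set set) species2)
            \<cong>\<^sub>s (One +\<^sub>s Sort_X +\<^sub>s Sort_Y) *\<^sub>s E_comp (at_least_two connected_PD))"
  by (rule conjI[OF semi_PD_iso PD_iso])

end
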